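(* Let $0<\alpha<2$ and let $X=(\omega_{i,i}^R,\omega_{i,j}^R,\omega_{i,j}^I)_{1\le i<j\le N}$ be an $\alpha$-stable random vector in $\mathbb{R}^{N^2}$ with Lévy measure $\nu$ given by $$\nu(B)=\int_{S^{N^2-1}}\sigma(d\xi)\int_0^{+\infty}\mathbf{1}_B(r\xi)\frac{dr}{r^{1+\alpha}},\qquad B\in\mathcal{B}(\mathbb{R}^{N^2}).$$ Let $\mathbf{X_A}$ be the associated $N\times N$ random Hermitian matrix, $(\mathbf{X_A})_{i,j}=\frac{1}{\sqrt N}A_{i,j}\omega_{i,j}$, with $|A_{i,j}|\le a$, and let $C(\alpha)=4^\alpha(2-\alpha+e\alpha)/\big(\alpha(2-\alpha)\big)$. (i) Let $f:\mathbb{R}\to\mathbb{R}$ with $f\in Lip(1)$, and let $m(tr_N(f(\mathbf{X_A})))$ be any median of $tr_N(f(\mathbf{X_A}))$. Then $$\mathbb{P}^N\big(tr_N(f(\mathbf{X_A}))-m(tr_N(f(\mathbf{X_A})))\ge\delta\big)\le C(\alpha)(\sqrt2 a)^\alpha\frac{\sigma(S^{N^2-1})}{N^\alpha\delta^\alpha},$$ whenever $\delta N>\sqrt2 a\,[2\sigma(S^{N^2-1})C(\alpha)]^{1/\alpha}$. (ii) Let $\lambda_{max}(\mathbf{X_A})$ be the largest eigenvalue of $\mathbf{X_A}$ and let $m(\lambda_{max}(\mathbf{X_A}))$ be any median of $\lambda_{max}(\mathbf{X_A})$. Then $$\mathbb{P}^N\big(\lambda_{max}(\mathbf{X_A})-m(\lambda_{max}(\mathbf{X_A}))\ge\delta\big)\le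 C(\alpha)(\sqrt2 a)^\alpha\frac{\sigma(S^{N^2-1})}{N^{\alpha/2}\delta^\alpha},$$ whenever $\delta\sqrt N>\sqrt2 a\,[2\sigma(S^{N^2-1})C(\alpha)]^{1/\alpha}$.
   Context: Matrix model. $N\ge1$; $\mathbf{A}=(A_{i,j})_{1\le i,j\le N}$ is a non-random Hermitian matrix with $|A_{i,j}|\le a$ for all $i,j$, where $a>0$. The complex random variables $\omega_{i,j}=\omega_{i,j}^R+\sqrt{-1}\,\omega_{i,j}^I$ satisfy $\omega_{i,j}=\overline{\omega_{j,i}}$ and $\omega_{i,i}^I=0$. $\mathbf{X_A}$ is the $N\times N$ Hermitian matrix with entries $(\mathbf{X_A})_{i,j}=\frac1{\sqrt N}A_{i,j}\omega_{i,j}$. $X=(\omega_{i,i}^R,\omega_{i,j}^R,\omega_{i,j}^I)_{1\le i<j\le N}$ (with $1\le i\le N$ for $\omega_{i,i}^R$) is the vector in $\mathbb{R}^{N^2}$ of real parameters and $\mathbb{P}^N$ its law. For $f:\mathbb{R}\to\mathbb{R}$ and Hermitian $\mathbf{M}=\mathbf{U}\,\mathrm{diag}(\lambda_1,\dots,\lambda_N)\mathbf{U}^*$ with $\mathbf U$ unitary, $f(\mathbf{M})=\mathbf{U}\,\mathrm{diag}(f(\lambda_1),\dots,f(\lambda_N))\mathbf{U}^*$, and $tr_N(\mathbf{M})=\frac1N\sum_{i=1}^N\mathbf{M}_{i,i}$. $f\in Lip(c)$ means $|f(x)-f(y)|\le c|x-y|$ for all $x,y$. An $\alpha$-stable vector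 $X$ in $\mathbb{R}^d$ with Lévy measure $\nu$ has $\mathbb{E}e^{i\langle t,X\rangle}=\exp\{i\langle t,\beta\rangle+\int_{\mathbb{R}^d}(e^{i\langle t,u\rangle}-1-i\langle t,u\rangle\mathbf{1}_{\|u\|\le1})\nu(du)\}$ for some $\beta\in\mathbb{R}^d$, where $\|\cdot\|$ is the Euclidean norm and $\nu\not\equiv0$ has the displayed form with $\sigma$ (the spherical component) a finite positive measure on the unit sphere $S^{d-1}$ of $\mathbb{R}^d$. *)

theory Defs
  imports "HOL-Probability.Probability"
begin

section \<open>Stable random vectors\<close>

text \<open>
  Here \<open>\<sigma>\<close> lives on the Borel sets of the unit sphere itself, so that
  \<open>space \<sigma> = sphere 0 1\<close>.
\<close>

definition finite_sphere_measure :: "'v::euclidean_space measure \<Rightarrow> bool" where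
  "finite_sphere_measure \<sigma> \<longleftrightarrow>
     finite_measure \<sigma> \<and> sets \<sigma> = sets (restrict_space borel (sphere 0 1))"

definition stable_levy_measure ::
    "real \<Rightarrow> 'v::euclidean_space measure \<Rightarrow> 'v measure \<Rightarrow> bool" where
  "stable_levy_measure \<alpha> \<sigma> \<nu> \<longleftrightarrow>
     sets \<nu> = sets borel \<and> emeasure \<nu> (space \<nu>) \<noteq> 0 \<and>
     (\<forall>B\<in>sets borel. emeasure \<nu> B =
        (\<integral>\<^sup>+ \<xi>. (\<integral>\<^sup>+ r\<in>{0<..}. indicator B (r *\<^sub>R \<xi>) * ennreal (1 / r powr (1 + \<alpha>)) \<partial>lborel) \<partial>\<sigma>))"

text \<open>
  \<open>X\<close> is infinitely divisible without Gaussian component, with Levy measure \<open>\<nu>\<close>; it is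
  \<open>\<alpha>\<close>-stable when moreover \<open>stable_levy_measure \<alpha> \<sigma> \<nu>\<close>.
\<close>

definition levy_khintchine ::
    "'w measure \<Rightarrow> ('w \<Rightarrow> 'v::euclidean_space) \<Rightarrow> 'v measure \<Rightarrow> bool" where
  "levy_khintchine M X \<nu> \<longleftrightarrow>
     (\<exists>\<beta>. \<forall>t. (\<integral>w. iexp (t \<bullet> X w) \<partial>M) =
        exp (\<i> * complex_of_real (t \<bullet> \<beta>) +
          (\<integral>u. (iexp (t \<bullet> u) - 1
              - \<i> * complex_of_real (t \<bullet> u) * of_bool (norm u \<le> 1)) \<partial>\<nu>)))"

definition stable_vector ::
    "real \<Rightarrow> 'v::euclidean_space measure \<Rightarrow> 'v measure \<Rightarrow> 'w measure \<Rightarrow> ('w \<Rightarrow> 'v) \<Rightarrow> bool" where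
  "stable_vector \<alpha> \<sigma> \<nu> M X \<longleftrightarrow>
     finite_sphere_measure \<sigma> \<and> stable_levy_measure \<alpha> \<sigma> \<nu> \<and>
     X \<in> borel_measurable M \<and> levy_khintchine M X \<nu>"

definition stable_const :: "real \<Rightarrow> real" where
  "stable_const \<alpha> = 4 powr \<alpha> * (2 - \<alpha> + exp 1 * \<alpha>) / (\<alpha> * (2 - \<alpha>))"

definition is_median :: "'w measure \<Rightarrow> ('w \<Rightarrow> real) \<Rightarrow> real \<Rightarrow> bool" where
  "is_median M Y m \<longleftrightarrow>
     \<P>(w in M. Y w \<le> m) \<ge> 1 / 2 \<and> \<P>(w in M. Y w \<ge> m) \<ge> 1 / 2"


section \<open>Hermitian matrices\<close>

definition ctranspose :: "complex^'n^'n \<Rightarrow> complex^'n^'n" where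
  "ctranspose M = (\<chi> i j. cnj (M $ j $ i))"

definition hermitian :: "complex^'n^'n \<Rightarrow> bool" where
  "hermitian M \<longleftrightarrow> ctranspose M = M"

definition unitary :: "complex^'n^'n \<Rightarrow> bool" where
  "unitary U \<longleftrightarrow> U ** ctranspose U = mat 1 \<and> ctranspose U ** U = mat 1"

definition real_diag :: "('n \<Rightarrow> real) \<Rightarrow> complex^'n^'n" where
  "real_diag l = (\<chi> i j. if i = j then complex_of_real (l i) else 0)"

text \<open>
  For Hermitian \<open>M\<close> a spectral decomposition exists and the resulting matrix does not depend on
  its choice; for other \<open>M\<close> the value is unspecified.
\<close>

definition matrix_fun :: "(real \<Rightarrow> real) \<Rightarrow> complex^'n^'n \<Rightarrow> complex^'n^'n" where
  "matrix_fun f M = (THE F. \<exists>U l. unitary U \<and>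
     M = U ** real_diag l ** ctranspose U \<and>
     F = U ** real_diag (f \<circ> l) ** ctranspose U)"

definition tr_N :: "complex^'n^'n \<Rightarrow> complex" where
  "tr_N M = trace M / of_nat CARD('n)"

text \<open>For Hermitian \<open>M\<close> all eigenvalues are real, so the set below is the whole spectrum.\<close>

definition lambda_max :: "complex^'n^'n \<Rightarrow> real" where
  "lambda_max M = Max {l. \<exists>v. v \<noteq> 0 \<and> M *v v = complex_of_real l *s v}"


section \<open>The matrix model\<close>

text \<open>
  The vector of the \<open>N\<^sup>2\<close> real parameters, \<open>N = CARD('n)\<close>. Its coordinates are indexed by pairs:
  \<open>(i, i)\<close> carries the diagonal entry, and for \<open>i < j\<close> the index \<open>(i, j)\<close> carries the real part
  and \<open>(j, i)\<close> the imaginary part of the entry \<open>\<omega> i j\<close>.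
\<close>

definition param_vector ::
    "('n::{finite,linorder} \<Rightarrow> 'n \<Rightarrow> 'w \<Rightarrow> complex) \<Rightarrow> 'w \<Rightarrow> real^('n \<times> 'n)" where
  "param_vector \<omega> w =
     (\<chi> p. if fst p \<le> snd p then Re (\<omega> (fst p) (snd p) w) else Im (\<omega> (snd p) (fst p) w))"

definition random_matrix ::
    "complex^'n^'n \<Rightarrow> ('n::finite \<Rightarrow> 'n \<Rightarrow> 'w \<Rightarrow> complex) \<Rightarrow> 'w \<Rightarrow> complex^'n^'n" where
  "random_matrix A \<omega> w =
     (\<chi> i j. complex_of_real (1 / sqrt (real CARD('n))) * (A $ i $ j) * \<omega> i j w)"

end

theory Submission
  imports Defs "HOL-Real_Asymp.Real_Asymp"
begin

text \<open>
  Both statistics are Lipschitz functions of the parameter vector \<open>X\<close>, with constants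
  \<open>sqrt 2 * a / N\<close> and \<open>sqrt 2 * a / sqrt N\<close>: writing two Hermitian matrices as
  \<open>U diag(l) U*\<close> and \<open>V diag(k) V*\<close>, the numbers \<open>|(U* V)\<^sub>i\<^sub>j|\<^sup>2\<close> are doubly stochastic weights for which the
  weighted sum of \<open>(l\<^sub>i - k\<^sub>j)\<^sup>2\<close> is the squared Hilbert-Schmidt distance.

  For an \<open>L\<close>-Lipschitz \<open>F\<close> it then suffices to concentrate \<open>X\<close> itself around some point \<open>b\<close>, at
  scale \<open>R = \<delta> / (4 L)\<close>: if \<open>P(|X - b| \<ge> 2 R) < 1/2\<close>, every median of \<open>F(X)\<close> exceeds
  \<open>F(b) - \<delta>/2\<close>, so \<open>F(X) - m \<ge> \<delta>\<close> forces \<open>|X - b| \<ge> 2 R\<close>. Splitting the jumps at size \<open>R\<close>, a union bound for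
  the large ones and Chebyshev's inequality for the small ones give
  \<open>P(|X - b| \<ge> 2 R) \<le> \<nu>{|u| > R} + R\<^sup>-\<^sup>2 \<integral>\<^bsub>|u| \<le> R\<^esub> |u|\<^sup>2 d\<nu> = \<sigma>(S) R\<^sup>-\<^sup>\<alpha> (1/\<alpha> + 1/(2 - \<alpha>))\<close>.
  The splitting is carried out on sums of independent copies with law
  \<open>(1 - \<lambda>/n) \<delta>\<^sub>0 + \<nu>|\<^bsub>{|u| > \<epsilon>}\<^esub> / n\<close>, whose characteristic functions converge to that of \<open>X - b\<close>;
  Gaussian smoothing transfers the tail bound to the limit.
\<close>

section \<open>Hermitian matrices\<close>

text \<open>Maximise the quadratic form \<open>x \<bullet> T x\<close> over the unit sphere of
  \<open>S\<close>, a nonempty compact set. At a maximiser the residual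
  \<open>T x - c *\<^sub>R x\<close> lies in \<open>S\<close> and must vanish, since a small move
  along it would otherwise raise the form above \<open>c\<close> times the squared norm.\<close>

lemma self_adjoint_eigenvector:
  fixes T :: "'v::euclidean_space \<Rightarrow> 'v"
  assumes T: "linear T" and sa: "\<And>x y. x \<bullet> T y = T x \<bullet> y"
    and S: "subspace S" "S \<noteq> {0}" and inv: "\<And>x. x \<in> S \<Longrightarrow> T x \<in> S"
  obtains x c where "x \<in> S" "norm x = 1" "T x = c *\<^sub>R x"
proof -
  obtain y where y: "y \<in> S" "y \<noteq> 0"
    using S subspace_0 by blast
  have "(1 / norm y) *\<^sub>R y \<in> S \<inter> sphere 0 1"
    using y S by (auto simp: subspace_scale)
  moreover have "compact (S \<inter> sphere 0 1)"
    using S by (intro closed_Int_compact closed_subspace) auto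
  moreover have "continuous_on (S \<inter> sphere 0 1) (\<lambda>x. x \<bullet> T x)"
    using T by (intro continuous_intros linear_continuous_on) (simp add: linear_conv_bounded_linear)
  ultimately obtain x where x: "x \<in> S" "norm x = 1"
    and max: "\<And>y. y \<in> S \<Longrightarrow> norm y = 1 \<Longrightarrow> y \<bullet> T y \<le> x \<bullet> T x"
    using continuous_attains_sup[of "S \<inter> sphere 0 1" "\<lambda>x. x \<bullet> T x"] by fastforce
  define c where "c = x \<bullet> T x"
  have xx: "x \<bullet> x = 1"
    using x(2) by (simp add: norm_eq_1)
  have quad: "y \<bullet> T y \<le> c * (y \<bullet> y)" if "y \<in> S" for y
  proof (cases "y = 0")
    case True
    then show ?thesis by simp
  next
    case False
    define u where "u = (1 / norm y) *\<^sub>R y"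
    have u: "u \<in> S" "norm u = 1" "y = norm y *\<^sub>R u"
      using that S False by (auto simp: u_def subspace_scale)
    have "y \<bullet> T y = (norm y)\<^sup>2 * (u \<bullet> T u)"
      by (subst (1 2) u(3)) (simp add: linear_scale[OF T] power2_eq_square)
    also have "\<dots> \<le> (norm y)\<^sup>2 * c"
      unfolding c_def by (intro mult_left_mono max u) auto
    finally show ?thesis by (simp add: power2_norm_eq_inner mult.commute)
  qed
  define z where "z = T x - c *\<^sub>R x"
  have z: "z \<in> S"
    using S x inv by (simp add: z_def subspace_diff subspace_scale)
  define K where "K = c * (z \<bullet> z) - z \<bullet> T z"
  \<comment> \<open>Evaluate \<open>quad\<close> at \<open>x + t *\<^sub>R z\<close>. The constant
    terms cancel and the linear ones combine to \<open>2 * t * (z \<bullet> z)\<close>, because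
    \<open>z\<close> is the residual itself.\<close>
  have main: "2 * t * (z \<bullet> z) \<le> t\<^sup>2 * K" for t
  proof -
    have "x + t *\<^sub>R z \<in> S"
      using S x z by (simp add: subspace_add subspace_scale)
    from quad[OF this] have q: "c + 2 * t * (z \<bullet> T x) + t\<^sup>2 * (z \<bullet> T z)
        \<le> c * (1 + 2 * t * (z \<bullet> x) + t\<^sup>2 * (z \<bullet> z))"
      by (simp add: linear_add[OF T] linear_scale[OF T] xx
          sa[of x z] c_def[symmetric] inner_commute[of x z] inner_commute[of "T x" z]
          power2_eq_square algebra_simps)
    have zz: "z \<bullet> z = z \<bullet> T x - c * (z \<bullet> x)"
      by (subst (2) z_def) (simp add: inner_diff_right)
    have "2 * t * (z \<bullet> z) = 2 * t * (z \<bullet> T x) - c * (2 * t * (z \<bullet> x))"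
      unfolding zz by (simp only: right_diff_distrib mult_ac)
    with q show ?thesis
      unfolding K_def by (simp only: distrib_left right_diff_distrib mult_ac)
  qed
  have "z \<bullet> z = 0"
  proof (rule ccontr)
    assume "z \<bullet> z \<noteq> 0"
    then have p: "z \<bullet> z > 0" by simp
    \<comment> \<open>With this choice \<open>t * (\<bar>K\<bar> + 1) = z \<bullet> z\<close>, so
      the quadratic term is too small to balance the linear one. The \<open>+ 1\<close> keeps the
      denominator positive when \<open>K = 0\<close>.\<close>
    define t where "t = (z \<bullet> z) / (\<bar>K\<bar> + 1)"
    have t: "t > 0" using p by (simp add: t_def)
    have "t * (2 * (z \<bullet> z)) \<le> t * (t * K)"
      using main[of t] by (simp add: power2_eq_square mult_ac)
    then have "2 * (z \<bullet> z) \<le> t * K" using t by simp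
    also have "\<dots> \<le> t * (\<bar>K\<bar> + 1)" using t by (intro mult_left_mono) auto
    also have "\<dots> = z \<bullet> z" by (simp add: t_def)
    finally show False using p by simp
  qed
  then show ?thesis
    using that[of x c] x by (simp add: z_def)
qed

section \<open>Complex inner product and the spectral theorem\<close>

lemma ctranspose_nth [simp]: "ctranspose M $ i $ j = cnj (M $ j $ i)"
  by (simp add: ctranspose_def)

lemma ctranspose_mult: "ctranspose (A ** B) = ctranspose B ** ctranspose A"
  by (simp add: vec_eq_iff matrix_matrix_mult_def mult.commute)

lemma ctranspose_ctranspose [simp]: "ctranspose (ctranspose M) = M"
  by (simp add: vec_eq_iff)

lemma hermitian_nth: "hermitian M \<Longrightarrow> cnj (M $ i $ j) = M $ j $ i"
  by (metis hermitian_def ctranspose_nth)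

text \<open>Conjugate-linear in the second argument. Its real part is the Euclidean inner product of
  \<open>complex^'n\<close> as a real space, which lets the real lemma
  \<open>self_adjoint_eigenvector\<close> act on complex matrices.\<close>

definition cinner :: "complex^'n \<Rightarrow> complex^'n \<Rightarrow> complex" where
  "cinner x y = (\<Sum>k\<in>UNIV. x $ k * cnj (y $ k))"

lemma Re_cinner: "Re (cinner x y) = x \<bullet> y"
  by (simp add: cinner_def inner_vec_def inner_complex_def)

lemma Im_cinner: "Im (cinner x y) = x \<bullet> (\<i> *s y)"
  by (simp add: cinner_def inner_vec_def inner_complex_def algebra_simps sum.distrib sum_subtractf)

lemma cinner_scale_right: "cinner x (c *s y) = cnj c * cinner x y"
  by (simp add: cinner_def sum_distrib_left mult_ac)

lemma cinner_hermitian: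
  assumes "hermitian M"
  shows "cinner (M *v x) y = cinner x (M *v y)"
proof -
  have "cinner (M *v x) y = (\<Sum>i\<in>UNIV. \<Sum>j\<in>UNIV. M $ i $ j * x $ j * cnj (y $ i))"
    by (simp add: cinner_def matrix_vector_mult_def sum_distrib_right)
  also have "\<dots> = (\<Sum>j\<in>UNIV. \<Sum>i\<in>UNIV. M $ i $ j * x $ j * cnj (y $ i))"
    by (rule sum.swap)
  also have "\<dots> = cinner x (M *v y)"
    by (simp add: cinner_def matrix_vector_mult_def sum_distrib_left hermitian_nth[OF assms] mult_ac)
  finally show ?thesis .
qed

text \<open>Induction on the number of eigenvectors already found. Their complex orthogonal
  complement is invariant under \<open>M\<close>, and nonzero by a count of real dimensions, so it
  contains a further unit eigenvector.\<close>

lemma hermitian_orthonormal_eigenvectors: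
  fixes M :: "complex^'n^'n"
  assumes M: "hermitian M" and "finite I"
  shows "\<exists>v l. (\<forall>i\<in>I. M *v v i = complex_of_real (l i) *s v i) \<and>
    (\<forall>i\<in>I. \<forall>j\<in>I. cinner (v i) (v j) = of_bool (i = (j::'n)))"
  using \<open>finite I\<close>
proof (induction I rule: finite_induct)
  case empty
  then show ?case by simp
next
  case (insert k I)
  then obtain v l where ev: "\<And>i. i \<in> I \<Longrightarrow> M *v v i = complex_of_real (l i) *s v i"
    and on: "\<And>i j. i \<in> I \<Longrightarrow> j \<in> I \<Longrightarrow> cinner (v i) (v j) = of_bool (i = j)"
    by metis
  define S where "S = {x. \<forall>i\<in>I. cinner x (v i) = 0}"
  \<comment> \<open>Complex orthogonality to \<open>v i\<close> amounts to real orthogonality to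
    both \<open>v i\<close> and \<open>\<i> *s v i\<close>.\<close>
  define B where "B = v ` I \<union> (\<lambda>i. \<i> *s v i) ` I"
  have S_eq: "S = {x. \<forall>b\<in>B. x \<bullet> b = 0}"
    by (auto simp: S_def B_def complex_eq_iff Re_cinner Im_cinner)
  have "dim B \<le> card B"
    using insert(1) by (intro dim_le_card') (auto simp: B_def)
  also have "\<dots> \<le> card I + card I"
    unfolding B_def by (intro order.trans[OF card_Un_le] add_mono card_image_le insert(1))
  \<comment> \<open>Strict because \<open>k\<close> is not in \<open>I\<close>; the right side is
    the real dimension of \<open>complex^'n\<close>.\<close>
  also have "\<dots> < 2 * CARD('n)"
    using insert(2) psubset_card_mono[of UNIV I] by fastforce
  finally have "dim B < DIM(complex^'n)" by simp
  then obtain x0 where x0: "x0 \<noteq> 0" "\<And>y. y \<in> span B \<Longrightarrow> orthogonal x0 y"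
    using orthogonal_to_subspace_exists[of B] by auto
  have "x0 \<in> S"
    using x0(2) by (auto simp: S_eq orthogonal_def span_base)
  moreover have "subspace S"
    unfolding S_eq by (auto simp: subspace_def inner_add_left)
  moreover have "M *v x \<in> S" if "x \<in> S" for x
    using that by (auto simp: S_def cinner_hermitian[OF M] ev cinner_scale_right)
  moreover have "x \<bullet> (M *v y) = (M *v x) \<bullet> y" for x y
    by (simp flip: Re_cinner add: cinner_hermitian[OF M])
  moreover have "linear ((*v) M)"
    by (rule linearI) (simp_all add: vec_eq_iff matrix_vector_mult_def distrib_left sum.distrib scaleR_sum_right)
  ultimately obtain x c where x: "x \<in> S" "norm x = 1" "M *v x = c *\<^sub>R x"
    using self_adjoint_eigenvector[of "(*v) M" S] x0(1) by blast
  have c: "M *v x = complex_of_real c *s x"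
    by (simp add: x(3) vec_eq_iff) (simp add: scaleR_conv_of_real)
  have xx: "cinner x x = 1"
    using x(2) by (simp add: complex_eq_iff Re_cinner norm_eq_1)
      (simp add: cinner_def)
  have sym: "cinner (v i) x = cnj (cinner x (v i))" for i
    by (simp add: cinner_def mult.commute)
  show ?case
    using x(1) c xx sym insert(2) ev on
    by (intro exI[of _ "v(k := x)"] exI[of _ "l(k := c)"]) (auto simp: S_def)
qed

theorem hermitian_spectral:
  fixes M :: "complex^'n^'n"
  assumes "hermitian M"
  obtains U l where "unitary U" "M = U ** real_diag l ** ctranspose U"
proof -
  obtain v :: "'n \<Rightarrow> complex^'n" and l where ev: "\<And>i. M *v v i = complex_of_real (l i) *s v i"
    and on: "\<And>i j. cinner (v i) (v j) = of_bool (i = j)"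
    using hermitian_orthonormal_eigenvectors[OF assms, of UNIV] by auto
  define U :: "complex^'n^'n" where "U = (\<chi> i j. v j $ i)"
  have 1: "ctranspose U ** U = mat 1"
    using on by (simp add: vec_eq_iff matrix_matrix_mult_def mat_def U_def cinner_def mult.commute of_bool_def)
  then have 2: "U ** ctranspose U = mat 1"
    using matrix_left_right_inverse by blast
  have "M ** U = U ** real_diag l"
    using ev by (simp add: vec_eq_iff matrix_matrix_mult_def matrix_vector_mult_def U_def real_diag_def
        mult_delta_right mult.commute)
  then have "U ** real_diag l ** ctranspose U = M"
    by (metis 2 matrix_mul_assoc matrix_mul_rid)
  with 1 2 show ?thesis
    by (intro that[of U l]) (auto simp: unitary_def)
qed

section \<open>Unitary changes of basis and functional calculus\<close>

lemma real_diag_mult_nth [simp]: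
  "(real_diag l ** W) $ i $ j = complex_of_real (l i) * W $ i $ j"
  "(W ** real_diag l) $ i $ j = W $ i $ j * complex_of_real (l j)"
  by (simp_all add: real_diag_def matrix_matrix_mult_def mult_delta_right mult_delta_left)

lemma unitaryD: "unitary U \<Longrightarrow> U ** ctranspose U = mat 1" "unitary U \<Longrightarrow> ctranspose U ** U = mat 1"
  by (auto simp: unitary_def)

lemma unitary_mult: "unitary U \<Longrightarrow> unitary V \<Longrightarrow> unitary (U ** V)"
  unfolding unitary_def ctranspose_mult
  by (metis matrix_mul_assoc matrix_mul_rid)

lemma unitary_ctranspose: "unitary U \<Longrightarrow> unitary (ctranspose U)"
  by (simp add: unitary_def)

lemma unitary_sum_rows:
  assumes "unitary W"
  shows "(\<Sum>j\<in>UNIV. (cmod (W $ i $ j))\<^sup>2) = 1"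
proof -
  have "(W ** ctranspose W) $ i $ i = 1"
    using assms by (simp add: unitary_def mat_def)
  then have "complex_of_real (\<Sum>j\<in>UNIV. (cmod (W $ i $ j))\<^sup>2) = 1"
    unfolding of_real_sum complex_norm_square by (simp add: matrix_matrix_mult_def)
  then show ?thesis by (simp only: of_real_eq_1_iff)
qed

lemma unitary_sum_columns:
  assumes "unitary W"
  shows "(\<Sum>i\<in>UNIV. (cmod (W $ i $ j))\<^sup>2) = 1"
  using unitary_sum_rows[OF unitary_ctranspose[OF assms], of j] by simp

lemma matrix_mult_diff:
  fixes A B C :: "'a::ring_1^'n^'n"
  shows "A ** (B - C) = A ** B - A ** C" "(A - B) ** C = A ** C - B ** C"
  by (simp_all add: vec_eq_iff matrix_matrix_mult_def sum_subtractf right_diff_distrib left_diff_distrib)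

text \<open>The outer unitary factors cancel and leave
  \<open>real_diag l ** W - W ** real_diag k\<close> with \<open>W = ctranspose U ** V\<close>. For
  equal matrices this makes the functional calculus well defined; for different ones it compares the
  two spectra.\<close>

lemma diagonalization_intertwines:
  assumes "unitary U" "unitary V"
  shows "(ctranspose U ** ((U ** real_diag l ** ctranspose U) - (V ** real_diag k ** ctranspose V)) ** V) $ i $ j =
    complex_of_real (l i - k j) * (ctranspose U ** V) $ i $ j"
proof -
  have "ctranspose U ** ((U ** real_diag l ** ctranspose U) - (V ** real_diag k ** ctranspose V)) ** V =
     (ctranspose U ** U) ** real_diag l ** (ctranspose U ** V) -
     (ctranspose U ** V) ** real_diag k ** (ctranspose V ** V)"
    by (simp add: matrix_mult_diff matrix_mul_assoc)
  also have "\<dots> = real_diag l ** (ctranspose U ** V) - (ctranspose U ** V) ** real_diag k"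
    using assms by (simp add: unitaryD)
  finally have eq: "ctranspose U ** ((U ** real_diag l ** ctranspose U) - (V ** real_diag k ** ctranspose V)) ** V = \<dots>" .
  show ?thesis
    unfolding eq by (simp add: left_diff_distrib mult.commute)
qed

text \<open>Makes the \<open>THE\<close> in \<open>matrix_fun\<close> usable. The matrix
  \<open>W\<close> relating two diagonalisations intertwines \<open>real_diag l\<close> with
  \<open>real_diag k\<close>, hence also the diagonals after \<open>f\<close> has been
  applied.\<close>

lemma matrix_fun_eq:
  fixes M :: "complex^'n^'n"
  assumes U: "unitary U" and M: "M = U ** real_diag l ** ctranspose U"
  shows "matrix_fun f M = U ** real_diag (f \<circ> l) ** ctranspose U"
  unfolding matrix_fun_def
proof (rule the_equality)
  show "\<exists>U' l'. unitary U' \<and> M = U' ** real_diag l' ** ctranspose U' \<and>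
     U ** real_diag (f \<circ> l) ** ctranspose U = U' ** real_diag (f \<circ> l') ** ctranspose U'"
    using U M by blast
next
  fix F :: "complex^'n^'n"
  assume "\<exists>V k. unitary V \<and> M = V ** real_diag k ** ctranspose V \<and> F = V ** real_diag (f \<circ> k) ** ctranspose V"
  then obtain V k where V: "unitary V" "M = V ** real_diag k ** ctranspose V"
    and F: "F = V ** real_diag (f \<circ> k) ** ctranspose V" by blast
  define W where "W = ctranspose U ** V"
  have W: "real_diag l ** W = W ** real_diag k"
  proof -
    have "complex_of_real (l i - k j) * W $ i $ j = 0" for i j
      using diagonalization_intertwines[OF U V(1), of l k i j]
      unfolding M[symmetric] V(2)[symmetric] W_def[symmetric]
      by (simp add: matrix_mult_diff)
    then show ?thesis
      by (simp add: vec_eq_iff mult.commute)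
  qed
  have "complex_of_real (l i) * W $ i $ j = W $ i $ j * complex_of_real (k j)" for i j
    using arg_cong[OF W, of "\<lambda>A. A $ i $ j"] by simp
  \<comment> \<open>Entrywise, either \<open>W $ i $ j = 0\<close> or \<open>l i = k j\<close>; in
    both cases \<open>f\<close> may be applied to the two eigenvalues.\<close>
  then have "real_diag (f \<circ> l) ** W = W ** real_diag (f \<circ> k)"
    by (simp add: vec_eq_iff) metis
  then have "U ** (real_diag (f \<circ> l) ** W) ** ctranspose V = U ** (W ** real_diag (f \<circ> k)) ** ctranspose V"
    by simp
  then have "U ** real_diag (f \<circ> l) ** ctranspose U ** (V ** ctranspose V) = (U ** ctranspose U) ** V ** real_diag (f \<circ> k) ** ctranspose V"
    by (simp add: W_def matrix_mul_assoc)
  then show "F = U ** real_diag (f \<circ> l) ** ctranspose U"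
    by (simp add: F unitaryD U V)
qed

lemma trace_conjugate:
  assumes "unitary U"
  shows "trace (U ** real_diag l ** ctranspose U) = complex_of_real (\<Sum>i\<in>UNIV. l i)"
proof -
  have "trace (U ** real_diag l ** ctranspose U) = trace (ctranspose U ** (U ** real_diag l))"
    by (rule trace_mul_sym)
  also have "\<dots> = trace (real_diag l)"
    by (simp add: matrix_mul_assoc unitaryD[OF assms])
  finally show ?thesis
    by (simp add: trace_def real_diag_def)
qed

lemma Re_tr_N_matrix_fun:
  fixes M :: "complex^'n^'n"
  assumes "unitary U" "M = U ** real_diag l ** ctranspose U"
  shows "Re (tr_N (matrix_fun f M)) = (\<Sum>i\<in>UNIV. f (l i)) / CARD('n)"
  by (simp add: matrix_fun_eq[OF assms] tr_N_def trace_conjugate[OF assms(1)])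

text \<open>In the coordinates \<open>ctranspose U *v v\<close> the eigenvalue equation becomes
  diagonal. Since \<open>range l\<close> is finite and nonempty, \<open>Max\<close> is a genuine
  maximum.\<close>

lemma lambda_max_eq:
  fixes M :: "complex^'n^'n"
  assumes U: "unitary U" and M: "M = U ** real_diag l ** ctranspose U"
  shows "lambda_max M = Max (range l)"
proof -
  have "{c. \<exists>v. v \<noteq> 0 \<and> M *v v = complex_of_real c *s v} = range l"
  proof (intro equalityI subsetI)
    fix c assume "c \<in> {c. \<exists>v. v \<noteq> 0 \<and> M *v v = complex_of_real c *s v}"
    then obtain v where v: "v \<noteq> 0" "M *v v = complex_of_real c *s v" by blast
    define y where "y = ctranspose U *v v"
    have Uy: "U *v y = v"
      by (simp add: y_def matrix_vector_mul_assoc unitaryD[OF U])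
    then have "y \<noteq> 0" using v by auto
    then obtain i where i: "y $ i \<noteq> 0" by (auto simp: vec_eq_iff)
    have "real_diag l *v y = ctranspose U *v (M *v v)"
      by (simp add: y_def M matrix_vector_mul_assoc matrix_mul_assoc unitaryD[OF U])
    also have "\<dots> = complex_of_real c *s y"
      by (simp add: v y_def vector_scalar_commute)
    finally have "complex_of_real (l i) * y $ i = complex_of_real c * y $ i"
      by (auto simp: vec_eq_iff matrix_vector_mult_def real_diag_def mult_delta_left)
    with i show "c \<in> range l" by auto
  next
    fix c assume "c \<in> range l"
    then obtain i where c: "c = l i" by auto
    define v where "v = U *v axis i 1"
    have "ctranspose U *v v = axis i 1"
      by (simp add: v_def matrix_vector_mul_assoc unitaryD[OF U])
    then have "v \<noteq> 0" by (metis axis_eq_0_iff matrix_vector_mult_0_right zero_neq_one)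
    moreover have "real_diag l *v axis i 1 = complex_of_real (l i) *s axis i 1"
      by (simp add: vec_eq_iff matrix_vector_mult_def real_diag_def axis_def mult_delta_left mult_delta_right)
    then have "M *v v = complex_of_real c *s v"
      by (simp add: v_def M c matrix_vector_mul_assoc vector_scalar_commute unitaryD[OF U] flip: matrix_mul_assoc)
         (simp add: vector_scalar_commute flip: matrix_vector_mul_assoc)
    ultimately show "c \<in> {c. \<exists>v. v \<noteq> 0 \<and> M *v v = complex_of_real c *s v}" by blast
  qed
  then show ?thesis by (simp add: lambda_max_def)
qed


section \<open>Hilbert-Schmidt norm and Lipschitz bounds for spectral statistics\<close>

lemma norm_matrix_sq: "(norm A)\<^sup>2 = Re (trace (A ** ctranspose A))"
  and norm_matrix_sq_sum: "(norm A)\<^sup>2 = (\<Sum>i\<in>UNIV. \<Sum>j\<in>UNIV. (cmod (A $ i $ j))\<^sup>2)"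
  for A :: "complex^'n^'n"
proof -
  show "(norm A)\<^sup>2 = (\<Sum>i\<in>UNIV. \<Sum>j\<in>UNIV. (cmod (A $ i $ j))\<^sup>2)"
    by (simp add: norm_vec_def L2_set_def sum_nonneg)
  also have "\<dots> = Re (trace (A ** ctranspose A))"
    by (simp add: trace_def matrix_matrix_mult_def flip: complex_norm_square)
  finally show "(norm A)\<^sup>2 = Re (trace (A ** ctranspose A))" .
qed

text \<open>The squared norm is a trace, so cyclicity brings each unitary factor next to its
  inverse.\<close>

lemma norm_unitary_conjugate:
  fixes A :: "complex^'n^'n"
  assumes U: "unitary U" and V: "unitary V"
  shows "norm (ctranspose U ** A ** V) = norm A"
proof -
  have "trace (ctranspose U ** A ** V ** ctranspose (ctranspose U ** A ** V)) =
    trace (ctranspose U ** (A ** (V ** ctranspose V) ** ctranspose A ** U))"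
    by (simp add: ctranspose_mult matrix_mul_assoc)
  also have "\<dots> = trace (A ** ctranspose A ** U ** ctranspose U)"
    by (subst trace_mul_sym) (simp add: unitaryD[OF V])
  also have "\<dots> = trace (A ** ctranspose A)"
    by (simp add: unitaryD[OF U] flip: matrix_mul_assoc)
  finally have "(norm (ctranspose U ** A ** V))\<^sup>2 = (norm A)\<^sup>2"
    by (simp add: norm_matrix_sq)
  then show ?thesis by simp
qed

text \<open>The exact identity behind the Hoffman-Wielandt inequality. The weight stays inside the
  square as a \<open>cmod\<close>, which is the shape that Cauchy-Schwarz produces below.\<close>

lemma norm_diff_diagonalized:
  fixes M M' :: "complex^'n^'n"
  assumes U: "unitary U" "M = U ** real_diag l ** ctranspose U"
    and V: "unitary V" "M' = V ** real_diag k ** ctranspose V"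
  shows "(norm (M - M'))\<^sup>2 =
    (\<Sum>i\<in>UNIV. \<Sum>j\<in>UNIV. (cmod ((ctranspose U ** V) $ i $ j) * \<bar>l i - k j\<bar>)\<^sup>2)"
proof -
  have "(norm (M - M'))\<^sup>2 = (norm (ctranspose U ** (M - M') ** V))\<^sup>2"
    by (simp only: norm_unitary_conjugate[OF U(1) V(1)])
  also have "\<dots> = (\<Sum>i\<in>UNIV. \<Sum>j\<in>UNIV. (cmod (complex_of_real (l i - k j) * (ctranspose U ** V) $ i $ j))\<^sup>2)"
    by (simp only: norm_matrix_sq_sum U(2) V(2) diagonalization_intertwines[OF U(1) V(1)])
  finally show ?thesis
    by (simp add: norm_mult mult.commute del: of_real_diff)
qed

lemma tr_N_lipschitz:
  fixes M M' :: "complex^'n^'n"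
  assumes f: "1-lipschitz_on UNIV f" and M: "hermitian M" and M': "hermitian M'"
  shows "\<bar>Re (tr_N (matrix_fun f M)) - Re (tr_N (matrix_fun f M'))\<bar> \<le> norm (M - M') / sqrt (CARD('n))"
proof -
  obtain U l where U: "unitary U" "M = U ** real_diag l ** ctranspose U"
    using hermitian_spectral[OF M] .
  obtain V k where V: "unitary V" "M' = V ** real_diag k ** ctranspose V"
    using hermitian_spectral[OF M'] .
  define W where "W = ctranspose U ** V"
  have W: "unitary W"
    unfolding W_def by (intro unitary_mult unitary_ctranspose U V)
  define p where "p i j = (cmod (W $ i $ j))\<^sup>2" for i j
  have p1: "(\<Sum>j\<in>UNIV. p i j) = 1" and p2: "(\<Sum>i\<in>UNIV. p i j) = 1" for i j
    using unitary_sum_rows[OF W] unitary_sum_columns[OF W] by (simp_all add: p_def)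
  have fl: "\<bar>f x - f y\<bar> \<le> \<bar>x - y\<bar>" for x y
    using lipschitz_onD[OF f, of x y] by (simp add: dist_real_def)
  \<comment> \<open>Row sums equal to 1 insert the weights into the first sum, column sums equal to
    1 into the second; both become double sums with the same weights.\<close>
  have "(\<Sum>i\<in>UNIV. f (l i)) - (\<Sum>j\<in>UNIV. f (k j)) =
    (\<Sum>i\<in>UNIV. \<Sum>j\<in>UNIV. p i j * f (l i)) - (\<Sum>j\<in>UNIV. \<Sum>i\<in>UNIV. p i j * f (k j))"
    by (simp add: p1 p2 flip: sum_distrib_right)
  also have "\<dots> = (\<Sum>i\<in>UNIV. \<Sum>j\<in>UNIV. p i j * (f (l i) - f (k j)))"
    by (subst (2) sum.swap) (simp add: right_diff_distrib sum_subtractf)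
  also have "\<bar>\<dots>\<bar> \<le> (\<Sum>i\<in>UNIV. \<Sum>j\<in>UNIV. p i j * \<bar>l i - k j\<bar>)"
    by (intro order.trans[OF sum_abs] sum_mono)
       (simp add: abs_mult p_def mult_left_mono fl)
  \<comment> \<open>Each weight is a product of two equal factors: Cauchy-Schwarz gives one to the
    eigenvalue difference, and the other contributes \<open>sqrt (CARD('n))\<close> because each row
    of \<open>p\<close> sums to 1.\<close>
  also have "\<dots> = (\<Sum>x\<in>UNIV. \<bar>cmod (W $ fst x $ snd x)\<bar> * \<bar>cmod (W $ fst x $ snd x) * \<bar>l (fst x) - k (snd x)\<bar>\<bar>)"
    by (simp add: sum.cartesian_product p_def power2_eq_square abs_mult mult.assoc case_prod_unfold)
  also have "\<dots> \<le> L2_set (\<lambda>x. cmod (W $ fst x $ snd x)) UNIV *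
      L2_set (\<lambda>x. cmod (W $ fst x $ snd x) * \<bar>l (fst x) - k (snd x)\<bar>) UNIV"
    by (rule L2_set_mult_ineq)
  also have "L2_set (\<lambda>x. cmod (W $ fst x $ snd x)) UNIV = sqrt (\<Sum>i\<in>UNIV. \<Sum>j\<in>UNIV. p i j)"
    by (simp add: L2_set_def sum.cartesian_product p_def case_prod_unfold)
  also have "\<dots> = sqrt (CARD('n))"
    by (simp add: p1)
  also have "L2_set (\<lambda>x. cmod (W $ fst x $ snd x) * \<bar>l (fst x) - k (snd x)\<bar>) UNIV = norm (M - M')"
    using norm_diff_diagonalized[OF U V, folded W_def]
    by (simp add: L2_set_def sum.cartesian_product case_prod_unfold real_sqrt_unique)
  finally have "\<bar>(\<Sum>i\<in>UNIV. f (l i)) - (\<Sum>j\<in>UNIV. f (k j))\<bar> / CARD('n) \<le> sqrt CARD('n) * norm (M - M') / CARD('n)"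
    by (rule divide_right_mono) simp
  also have "\<dots> = norm (M - M') / sqrt CARD('n)"
    by (simp add: field_simps)
  finally show ?thesis
    by (simp add: Re_tr_N_matrix_fun[OF U] Re_tr_N_matrix_fun[OF V] flip: diff_divide_distrib)
qed

text \<open>Only the row of \<open>W\<close> belonging to a top eigenvalue \<open>l i\<close>
  matters. Its squared moduli are probability weights, so the gap is at most the weighted mean of
  \<open>\<bar>l i - k j\<bar>\<close>, and Cauchy-Schwarz bounds this mean by the root of the
  weighted mean square.\<close>

lemma lambda_max_diff_le:
  fixes M M' :: "complex^'n^'n"
  assumes M: "hermitian M" and M': "hermitian M'"
  shows "lambda_max M - lambda_max M' \<le> norm (M - M')"
proof -
  obtain U l where U: "unitary U" "M = U ** real_diag l ** ctranspose U"
    using hermitian_spectral[OF M] .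
  obtain V k where V: "unitary V" "M' = V ** real_diag k ** ctranspose V"
    using hermitian_spectral[OF M'] .
  define W where "W = ctranspose U ** V"
  have W: "unitary W"
    unfolding W_def by (intro unitary_mult unitary_ctranspose U V)
  obtain i where i: "lambda_max M = l i"
    using Max_in[of "range l"] by (fastforce simp: lambda_max_eq[OF U])
  have k: "k j \<le> lambda_max M'" for j
    by (simp add: lambda_max_eq[OF V])
  have "lambda_max M - lambda_max M' = (\<Sum>j\<in>UNIV. (cmod (W $ i $ j))\<^sup>2 * (l i - lambda_max M'))"
    by (simp add: i unitary_sum_rows[OF W] flip: sum_distrib_right)
  also have "\<dots> \<le> (\<Sum>j\<in>UNIV. (cmod (W $ i $ j))\<^sup>2 * \<bar>l i - k j\<bar>)"
    using k by (intro sum_mono mult_left_mono) (auto intro: order.trans[OF _ abs_ge_self])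
  also have "\<dots> = (\<Sum>j\<in>UNIV. \<bar>cmod (W $ i $ j)\<bar> * \<bar>cmod (W $ i $ j) * \<bar>l i - k j\<bar>\<bar>)"
    by (simp add: power2_eq_square abs_mult mult.assoc)
  also have "\<dots> \<le> L2_set (\<lambda>j. cmod (W $ i $ j)) UNIV * L2_set (\<lambda>j. cmod (W $ i $ j) * \<bar>l i - k j\<bar>) UNIV"
    by (rule L2_set_mult_ineq)
  also have "\<dots> = sqrt (\<Sum>j\<in>UNIV. (cmod (W $ i $ j) * \<bar>l i - k j\<bar>)\<^sup>2)"
    by (simp add: L2_set_def unitary_sum_rows[OF W])
  \<comment> \<open>The single row is one of the nonnegative terms of the double sum in
    \<open>norm_diff_diagonalized\<close>.\<close>
  also have "\<dots> \<le> sqrt (\<Sum>i\<in>UNIV. \<Sum>j\<in>UNIV. (cmod (W $ i $ j) * \<bar>l i - k j\<bar>)\<^sup>2)"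
    by (intro real_sqrt_le_mono member_le_sum[of i UNIV "\<lambda>i. \<Sum>j\<in>UNIV. (cmod (W $ i $ j) * \<bar>l i - k j\<bar>)\<^sup>2"])
      (auto intro: sum_nonneg)
  also have "\<dots> = norm (M - M')"
    using norm_diff_diagonalized[OF U V, folded W_def] by (simp add: real_sqrt_unique)
  finally show ?thesis .
qed

lemma lambda_max_lipschitz:
  fixes M M' :: "complex^'n^'n"
  assumes "hermitian M" "hermitian M'"
  shows "\<bar>lambda_max M - lambda_max M'\<bar> \<le> norm (M - M')"
  using lambda_max_diff_le[OF assms] lambda_max_diff_le[OF assms(2,1)] by (simp add: norm_minus_commute abs_le_iff)

section \<open>The matrix as a function of its real parameters\<close>

definition param_entry :: "real^('n::{finite,linorder} \<times> 'n) \<Rightarrow> 'n \<Rightarrow> 'n \<Rightarrow> complex" where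
  "param_entry x i j =
     (if i = j then Complex (x $ (i, i)) 0
      else if i < j then Complex (x $ (i, j)) (x $ (j, i))
      else Complex (x $ (j, i)) (- x $ (i, j)))"

text \<open>Defined for every \<open>x\<close>, with values that are Hermitian whenever
  \<open>A\<close> is, so that the statistics become Lipschitz functions on the whole parameter
  space.\<close>

definition param_matrix ::
    "complex^'n::{finite,linorder}^'n::{finite,linorder} \<Rightarrow> real^('n \<times> 'n) \<Rightarrow> complex^'n::{finite,linorder}^'n::{finite,linorder}" where
  "param_matrix A x = (\<chi> i j. complex_of_real (1 / sqrt (real CARD('n))) * A $ i $ j * param_entry x i j)"

lemma random_matrix_eq_param_matrix:
  assumes "\<And>i j. \<omega> i j w = cnj (\<omega> j i w)"
  shows "random_matrix A \<omega> w = param_matrix A (param_vector \<omega> w)"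
proof -
  have sym: "Re (\<omega> i j w) = Re (\<omega> j i w)" "Im (\<omega> i j w) = - Im (\<omega> j i w)" for i j
    using arg_cong[OF assms[of i j], of Re] arg_cong[OF assms[of i j], of Im] by simp_all
  have "Im (\<omega> i i w) = 0" for i
    using sym(2)[of i i] by simp
  then have "\<omega> i j w = param_entry (param_vector \<omega> w) i j" for i j
    using sym[of i j] by (auto simp: param_entry_def param_vector_def complex_eq_iff)
  then show ?thesis
    by (simp add: random_matrix_def param_matrix_def)
qed

lemma hermitian_param_matrix:
  assumes "hermitian A"
  shows "hermitian (param_matrix A x)"
proof -
  have "cnj (param_entry x j i) = param_entry x i j" for i j
    by (auto simp: param_entry_def complex_eq_iff)
  then show ?thesis
    by (simp add: hermitian_def vec_eq_iff param_matrix_def hermitian_nth[OF assms])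
qed

text \<open>Every off-diagonal parameter enters two entries, one above and one below the diagonal.
  This double count is the source of the factor \<open>sqrt 2\<close>.\<close>

lemma norm_param_matrix_diff:
  fixes A :: "complex^'n::{finite,linorder}^'n::{finite,linorder}"
  assumes a: "\<And>i j. cmod (A $ i $ j) \<le> a"
  shows "norm (param_matrix A x - param_matrix A y) \<le> sqrt 2 * a / sqrt (CARD('n)) * norm (x - y)"
proof -
  have a0: "0 \<le> a"
    using norm_ge_zero a by (rule order.trans)
  define z where "z = x - y"
  \<comment> \<open>An equality off the diagonal; on the diagonal the right side is twice the
    left.\<close>
  have entry: "(cmod (param_entry x i j - param_entry y i j))\<^sup>2 \<le> (z $ (i, j))\<^sup>2 + (z $ (j, i))\<^sup>2" for i j
    by (auto simp: param_entry_def z_def cmod_power2 complex_diff power2_commute)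
  have diff: "(param_matrix A x - param_matrix A y) $ i $ j =
      complex_of_real (1 / sqrt (CARD('n))) * A $ i $ j * (param_entry x i j - param_entry y i j)" for i j
    by (simp add: param_matrix_def right_diff_distrib diff_divide_distrib)
  have "(norm (param_matrix A x - param_matrix A y))\<^sup>2 =
     (\<Sum>i\<in>UNIV. \<Sum>j\<in>UNIV. (cmod (A $ i $ j))\<^sup>2 * (cmod (param_entry x i j - param_entry y i j))\<^sup>2 / CARD('n))"
    unfolding norm_matrix_sq_sum diff by (simp add: norm_mult norm_divide power_mult_distrib power_divide)
  also have "\<dots> \<le> (\<Sum>i\<in>UNIV. \<Sum>j\<in>UNIV. a\<^sup>2 * ((z $ (i, j))\<^sup>2 + (z $ (j, i))\<^sup>2) / CARD('n))"
    using a by (intro sum_mono divide_right_mono mult_mono entry power_mono) auto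
  also have "\<dots> = a\<^sup>2 / CARD('n) * ((\<Sum>i\<in>UNIV. \<Sum>j\<in>UNIV. (z $ (i, j))\<^sup>2) + (\<Sum>i\<in>UNIV. \<Sum>j\<in>UNIV. (z $ (j, i))\<^sup>2))"
    by (simp add: sum.distrib sum_distrib_left distrib_left add_divide_distrib)
  also have "(\<Sum>i\<in>UNIV. \<Sum>j\<in>UNIV. (z $ (j, i))\<^sup>2) = (\<Sum>i\<in>UNIV. \<Sum>j\<in>UNIV. (z $ (i, j))\<^sup>2)"
    by (rule sum.swap)
  also have "\<dots> = (norm z)\<^sup>2"
    by (simp add: norm_vec_def L2_set_def sum_nonneg sum.cartesian_product case_prod_unfold)
  also have "a\<^sup>2 / CARD('n) * ((norm z)\<^sup>2 + (norm z)\<^sup>2) = (sqrt 2 * a / sqrt (CARD('n)) * norm z)\<^sup>2"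
    by (simp add: power_mult_distrib power_divide)
  finally show ?thesis
    using a0 by (simp add: z_def power2_le_iff_abs_le)
qed

section \<open>Tail bounds from convergence of characteristic functions\<close>

lemma iexp_sum: "finite I \<Longrightarrow> iexp (\<Sum>i\<in>I. f i) = (\<Prod>i\<in>I. iexp (f i))"
  by (simp add: sum_distrib_left exp_sum)

lemma exp_norm_sq_prod:
  "exp (- (norm x)\<^sup>2 / c) = (\<Prod>b\<in>Basis. exp (- (x \<bullet> b)\<^sup>2 / c))" for x :: "'v::euclidean_space"
proof -
  have "(norm x)\<^sup>2 = (\<Sum>b\<in>Basis. (x \<bullet> b)\<^sup>2)"
    unfolding power2_norm_eq_inner by (subst euclidean_inner) (simp add: power2_eq_square)
  then have "- (norm x)\<^sup>2 / c = (\<Sum>b\<in>Basis. - (x \<bullet> b)\<^sup>2 / c)"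
    by (simp add: sum_negf sum_divide_distrib)
  then show ?thesis by (simp add: exp_sum)
qed

text \<open>The standard normal law in the coordinates of \<open>Basis\<close>; independence
  factorises its characteristic function. Read from right to left, the formula represents a Gaussian
  function as an average of characters.\<close>

lemma gaussian_char_measure:
  obtains N :: "'v::euclidean_space measure" where "prob_space N" "sets N = sets borel"
    "\<And>x. (\<integral>t. iexp (x \<bullet> t) \<partial>N) = complex_of_real (exp (- (norm x)\<^sup>2 / 2))"
proof -
  interpret S: prob_space std_normal_distribution
    by (rule prob_space_normal_density) simp
  interpret P: product_prob_space "\<lambda>_::'v. std_normal_distribution" Basis
    by standard
  define F where "F z = (\<Sum>b\<in>Basis. z b *\<^sub>R b)" for z :: "'v \<Rightarrow> real"
  define N where "N = distr (PiM Basis (\<lambda>_. std_normal_distribution)) borel F"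
  have F: "F \<in> measurable (PiM Basis (\<lambda>_. std_normal_distribution)) borel"
    unfolding F_def by measurable
  show ?thesis
  proof (rule that[of N])
    show "prob_space N"
      unfolding N_def using F by (rule P.prob_space_distr)
    show "sets N = sets borel" by (simp add: N_def)
    fix x :: 'v
    have "(\<integral>t. iexp (x \<bullet> t) \<partial>N) = (\<integral>z. iexp (\<Sum>b\<in>Basis. (x \<bullet> b) * z b) \<partial>PiM Basis (\<lambda>_. std_normal_distribution))"
      unfolding N_def by (subst integral_distr[OF F]) (simp_all add: F_def inner_sum_right mult.commute)
    also have "\<dots> = (\<integral>z. (\<Prod>b\<in>Basis. iexp ((x \<bullet> b) * z b)) \<partial>PiM Basis (\<lambda>_. std_normal_distribution))"
      by (simp only: iexp_sum[OF finite_Basis])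
    also have "\<dots> = (\<Prod>b\<in>Basis. \<integral>z. iexp ((x \<bullet> b) * z) \<partial>std_normal_distribution)"
      by (intro P.product_integral_prod S.integrable_const_bound[where B=1]) auto
    also have "\<dots> = (\<Prod>b\<in>Basis. char std_normal_distribution (x \<bullet> b))"
      by (simp add: char_def)
    also have "\<dots> = complex_of_real (\<Prod>b\<in>Basis. exp (- (x \<bullet> b)\<^sup>2 / 2))"
      by (simp add: char_std_normal_distribution)
    also have "(\<Prod>b\<in>Basis. exp (- (x \<bullet> b)\<^sup>2 / 2)) = exp (- (norm x)\<^sup>2 / 2)"
      by (rule exp_norm_sq_prod[symmetric])
    finally show "(\<integral>t. iexp (x \<bullet> t) \<partial>N) = complex_of_real (exp (- (norm x)\<^sup>2 / 2))" .
  qed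
qed

text \<open>Left unnormalised: the peak value is 1, and the total mass appears as the constant
  \<open>c\<close> in the smoothing estimates.\<close>

definition gauss :: "real \<Rightarrow> 'v::euclidean_space \<Rightarrow> real" where
  "gauss s x = exp (- (norm x)\<^sup>2 / (2 * s\<^sup>2))"

lemma gauss_measurable [measurable (raw)]:
  assumes [measurable]: "f \<in> borel_measurable M"
  shows "(\<lambda>x. gauss s (f x)) \<in> borel_measurable M"
  unfolding gauss_def by measurable

lemma gauss_nonneg [simp]: "0 \<le> gauss s x" and gauss_le_1: "gauss s x \<le> 1"
  by (simp_all add: gauss_def)

lemma gauss_minus [simp]: "gauss s (- x) = gauss s x"
  by (simp add: gauss_def)

lemma has_bochner_integral_gauss:
  fixes s :: real
  assumes s: "0 < s"
  shows "has_bochner_integral lborel (gauss s :: 'v::euclidean_space \<Rightarrow> real) (sqrt (2 * pi * s\<^sup>2) ^ DIM('v))"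
proof (rule has_bochner_integral_nn_integral)
  have 1: "(\<integral>\<^sup>+x. ennreal (exp (- x\<^sup>2 / (2 * s\<^sup>2))) \<partial>lborel) = ennreal (sqrt (2 * pi * s\<^sup>2))"
  proof -
    have eq: "exp (- x\<^sup>2 / (2 * s\<^sup>2)) = sqrt (2 * pi * s\<^sup>2) * normal_density 0 s x" for x
      using s by (simp add: normal_density_def)
    have "has_bochner_integral lborel (normal_density 0 s) 1"
      using s by (simp add: has_bochner_integral_iff )
    then have "has_bochner_integral lborel (\<lambda>x. exp (- x\<^sup>2 / (2 * s\<^sup>2))) (sqrt (2 * pi * s\<^sup>2) * 1)"
      unfolding eq by (rule has_bochner_integral_mult_right)
    then show ?thesis
      by (subst nn_integral_eq_integral) (auto simp: has_bochner_integral_iff)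
  qed
  have "gauss s x = (\<Prod>b\<in>Basis. exp (- (x \<bullet> b)\<^sup>2 / (2 * s\<^sup>2)))" for x :: 'v
    unfolding gauss_def by (rule exp_norm_sq_prod)
  then have "(\<integral>\<^sup>+x. ennreal (gauss s (x::'v)) \<partial>lborel) =
    (\<integral>\<^sup>+x. (\<Prod>b\<in>Basis. ennreal (exp (- ((x::'v) \<bullet> b)\<^sup>2 / (2 * s\<^sup>2)))) \<partial>lborel)"
    by (simp add: prod_ennreal)
  also have "\<dots> = (\<Prod>b\<in>(Basis::'v set). \<integral>\<^sup>+x. ennreal (exp (- x\<^sup>2 / (2 * s\<^sup>2))) \<partial>lborel)"
    by (rule nn_integral_lborel_prod) auto
  also have "\<dots> = ennreal (sqrt (2 * pi * s\<^sup>2) ^ DIM('v))"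
    unfolding 1 by (simp add: ennreal_power)
  finally show "(\<integral>\<^sup>+x. ennreal (gauss s (x::'v)) \<partial>lborel) = ennreal (sqrt (2 * pi * s\<^sup>2) ^ DIM('v))" .
qed auto

text \<open>A Gaussian test function is an average of characters over the probability measure
  \<open>N\<close>. Its integral is therefore an average of the characteristic function, and
  dominated convergence applies because characteristic functions are bounded by 1.\<close>

lemma char_convergence_gauss:
  fixes \<mu> :: "nat \<Rightarrow> 'v::euclidean_space measure" and \<mu>' :: "'v measure"
  assumes prob: "\<And>k. prob_space (\<mu> k)" and sets[measurable_cong]: "\<And>k. sets (\<mu> k) = sets borel"
    and prob': "prob_space \<mu>'" and sets'[measurable_cong]: "sets \<mu>' = sets borel"
    and conv: "\<And>t. (\<lambda>k. \<integral>x. iexp (t \<bullet> x) \<partial>\<mu> k) \<longlonglongrightarrow> (\<integral>x. iexp (t \<bullet> x) \<partial>\<mu>')"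
    and s: "0 < s"
  shows "(\<lambda>k. \<integral>x. gauss s (x - y) \<partial>\<mu> k) \<longlonglongrightarrow> (\<integral>x. gauss s (x - y) \<partial>\<mu>')"
proof -
  obtain N :: "'v measure" where "prob_space N" and setsN[measurable_cong]: "sets N = sets borel"
    and N: "\<And>x. (\<integral>t. iexp (x \<bullet> t) \<partial>N) = complex_of_real (exp (- (norm x)\<^sup>2 / 2))"
    by (rule gaussian_char_measure) blast
  interpret N: prob_space N by fact
  define \<phi> where "\<phi> \<eta> t = (\<integral>x. iexp (t \<bullet> x) \<partial>\<eta>)" for \<eta> and t :: 'v
  \<comment> \<open>A Parseval identity, obtained by Fubini. Rescaling by \<open>s\<close> reduces
    \<open>gauss s\<close> to the standard Gaussian; the shift \<open>y\<close> becomes a phase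
    factor.\<close>
  have smoothed: "complex_of_real (\<integral>x. gauss s (x - y) \<partial>\<eta>) =
      (\<integral>t. iexp (- (y \<bullet> t) / s) * \<phi> \<eta> (t /\<^sub>R s) \<partial>N)"
    if "prob_space \<eta>" and [measurable_cong]: "sets \<eta> = sets borel" for \<eta> :: "'v measure"
  proof -
    interpret \<eta>: prob_space \<eta> by fact
    interpret pair_prob_space N \<eta> ..
    have g: "gauss s v = exp (- (norm (v /\<^sub>R s))\<^sup>2 / 2)" for v :: 'v
      using s by (simp add: gauss_def power_mult_distrib field_simps)
    have "complex_of_real (\<integral>x. gauss s (x - y) \<partial>\<eta>) = (\<integral>x. complex_of_real (exp (- (norm ((x - y) /\<^sub>R s))\<^sup>2 / 2)) \<partial>\<eta>)"
      by (simp only: g integral_complex_of_real)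
    also have "\<dots> = (\<integral>x. (\<integral>t. iexp (((x - y) /\<^sub>R s) \<bullet> t) \<partial>N) \<partial>\<eta>)"
      by (simp only: N)
    also have "\<dots> = (\<integral>t. (\<integral>x. iexp (((x - y) /\<^sub>R s) \<bullet> t) \<partial>\<eta>) \<partial>N)"
      by (rule Fubini_integral, rule P.integrable_const_bound[where B=1]) auto
    also have "\<dots> = (\<integral>t. (\<integral>x. iexp (- (y \<bullet> t) / s) * iexp ((t /\<^sub>R s) \<bullet> x) \<partial>\<eta>) \<partial>N)"
    proof (intro Bochner_Integration.integral_cong refl)
      fix t x
      have "((x - y) /\<^sub>R s) \<bullet> t = - (y \<bullet> t) / s + (t /\<^sub>R s) \<bullet> x"
        using s by (simp add: inner_diff_left inner_diff_right inner_commute field_simps)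
      then show "iexp (((x - y) /\<^sub>R s) \<bullet> t) = iexp (- (y \<bullet> t) / s) * iexp ((t /\<^sub>R s) \<bullet> x)"
        by (simp only: of_real_add distrib_left exp_add)
    qed
    finally show ?thesis unfolding \<phi>_def by simp
  qed
  have bound: "norm (\<phi> (\<mu> k) t) \<le> 1" for t k
  proof -
    interpret prob_space "\<mu> k" by (rule prob)
    show ?thesis
      unfolding \<phi>_def by (rule order.trans[OF integral_norm_bound]) (simp add: prob_space)
  qed
  have meas: "(\<lambda>t. \<phi> \<eta> (t /\<^sub>R s)) \<in> borel_measurable borel"
    if "prob_space \<eta>" and [measurable_cong]: "sets \<eta> = sets borel" for \<eta> :: "'v measure"
  proof -
    interpret \<eta>: prob_space \<eta> by fact
    show ?thesis unfolding \<phi>_def by measurable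
  qed
  have [measurable]: "(\<lambda>t. \<phi> (\<mu> k) (t /\<^sub>R s)) \<in> borel_measurable N"
    "(\<lambda>t. \<phi> \<mu>' (t /\<^sub>R s)) \<in> borel_measurable N" for k
    using meas[OF prob sets] meas[OF prob' sets'] by (simp_all add: measurable_cong_sets[OF setsN refl])
  have "(\<lambda>k. \<integral>t. iexp (- (y \<bullet> t) / s) * \<phi> (\<mu> k) (t /\<^sub>R s) \<partial>N)
     \<longlonglongrightarrow> (\<integral>t. iexp (- (y \<bullet> t) / s) * \<phi> \<mu>' (t /\<^sub>R s) \<partial>N)"
  proof (rule integral_dominated_convergence[where w="\<lambda>_. 1"])
    show "AE t in N. (\<lambda>k. iexp (- (y \<bullet> t) / s) * \<phi> (\<mu> k) (t /\<^sub>R s)) \<longlonglongrightarrow> iexp (- (y \<bullet> t) / s) * \<phi> \<mu>' (t /\<^sub>R s)"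
      unfolding \<phi>_def by (intro AE_I2 tendsto_mult tendsto_const conv)
    show "AE t in N. norm (iexp (- (y \<bullet> t) / s) * \<phi> (\<mu> k) (t /\<^sub>R s)) \<le> 1" for k
      by (simp only: norm_mult norm_exp_i_times bound mult_1_left AE_I2)
  qed (auto intro!: borel_measurable_times)
  then have "(\<lambda>k. complex_of_real (\<integral>x. gauss s (x - y) \<partial>\<mu> k)) \<longlonglongrightarrow> complex_of_real (\<integral>x. gauss s (x - y) \<partial>\<mu>')"
    by (simp only: smoothed[OF prob sets] smoothed[OF prob' sets'])
  then show ?thesis
    by (simp only: tendsto_of_real_iff)
qed


text \<open>Convolution of the indicator of a ball with \<open>gauss s\<close>: a stand-in for the
  total Gaussian mass times that indicator, for which convergence of integrals follows from
  convergence of characteristic functions.\<close>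

definition smoothed_ball :: "real \<Rightarrow> real \<Rightarrow> 'v::euclidean_space \<Rightarrow> real" where
  "smoothed_ball s \<rho> x = (\<integral>y. indicat_real (ball 0 \<rho>) y * gauss s (x - y) \<partial>lborel)"

lemma ball_measurable [measurable]: "ball (c::'v::euclidean_space) \<rho> \<in> sets borel"
  by simp

lemma integrable_indicat_ball: "integrable lborel (indicat_real (ball (c::'v::euclidean_space) \<rho>))"
  using emeasure_bounded_finite[of "ball c \<rho>"] by (intro integrable_real_indicator) auto

text \<open>Integrate the Gaussian case over centres \<open>y\<close> in the ball. The ball has
  finite Lebesgue measure, so its indicator dominates.\<close>

lemma char_convergence_smoothed_ball:
  fixes \<mu> :: "nat \<Rightarrow> 'v::euclidean_space measure" and \<mu>' :: "'v measure"
  assumes prob: "\<And>k. prob_space (\<mu> k)" and sets[measurable_cong]: "\<And>k. sets (\<mu> k) = sets borel"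
    and prob': "prob_space \<mu>'" and sets'[measurable_cong]: "sets \<mu>' = sets borel"
    and conv: "\<And>t. (\<lambda>k. \<integral>x. iexp (t \<bullet> x) \<partial>\<mu> k) \<longlonglongrightarrow> (\<integral>x. iexp (t \<bullet> x) \<partial>\<mu>')"
    and s: "0 < s"
  shows "(\<lambda>k. \<integral>x. smoothed_ball s \<rho> x \<partial>\<mu> k) \<longlonglongrightarrow> (\<integral>x. smoothed_ball s \<rho> x \<partial>\<mu>')"
proof -
  let ?I = "indicat_real (ball (0::'v) \<rho>)"
  have Fubini: "(\<integral>x. smoothed_ball s \<rho> x \<partial>\<eta>) = (\<integral>y. ?I y * (\<integral>x. gauss s (x - y) \<partial>\<eta>) \<partial>lborel)"
    if "prob_space \<eta>" and [measurable_cong]: "sets \<eta> = sets borel" for \<eta> :: "'v measure"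
  proof -
    interpret \<eta>: prob_space \<eta> by fact
    interpret pair_sigma_finite "lborel :: 'v measure" \<eta> ..
    have "integrable (lborel \<Otimes>\<^sub>M \<eta>) (\<lambda>(y, x). ?I y * gauss s (x - y))"
    proof (rule Bochner_Integration.integrable_bound)
      show "integrable (lborel \<Otimes>\<^sub>M \<eta>) (indicat_real (ball (0::'v) \<rho> \<times> space \<eta>))"
        using emeasure_bounded_finite[of "ball (0::'v) \<rho>"]
        by (intro integrable_real_indicator) (auto simp: \<eta>.emeasure_pair_measure_Times \<eta>.emeasure_space_1)
    qed (auto simp: gauss_le_1 space_pair_measure indicator_def)
    from Fubini_integral[OF this] show ?thesis
      unfolding smoothed_ball_def by simp
  qed
  have meas [measurable]: "(\<lambda>y. \<integral>x. gauss s (x - y) \<partial>\<eta>) \<in> borel_measurable borel"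
    if "prob_space \<eta>" and [measurable_cong]: "sets \<eta> = sets borel" for \<eta> :: "'v measure"
  proof -
    interpret \<eta>: prob_space \<eta> by fact
    show ?thesis by measurable
  qed
  have bound: "norm (\<integral>x. gauss s (x - y) \<partial>\<mu> k) \<le> 1" for y k
  proof -
    interpret prob_space "\<mu> k" by (rule prob)
    have "norm (\<integral>x. gauss s (x - y) \<partial>\<mu> k) \<le> (\<integral>x. 1 \<partial>\<mu> k)"
      by (intro Bochner_Integration.integral_norm_bound_integral integrable_const integrable_const_bound[where B=1])
        (auto simp: gauss_le_1)
    then show ?thesis by (simp add: prob_space)
  qed
  have "(\<lambda>k. \<integral>y. ?I y * (\<integral>x. gauss s (x - y) \<partial>\<mu> k) \<partial>lborel)
     \<longlonglongrightarrow> (\<integral>y. ?I y * (\<integral>x. gauss s (x - y) \<partial>\<mu>') \<partial>lborel)"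
    using prob prob' sets sets' bound
    by (intro integral_dominated_convergence[where w="?I"] AE_I2 tendsto_mult tendsto_const
        char_convergence_gauss[OF prob sets prob' sets' conv s])
      (auto simp: abs_mult integrable_indicat_ball split: split_indicator)
  then show ?thesis
    by (simp only: Fubini[OF prob sets] Fubini[OF prob' sets'])
qed

text \<open>After a shift the value is the Gaussian mass of those \<open>z\<close> with
  \<open>norm (x + z) < \<rho>\<close>. For \<open>x\<close> at distance \<open>\<eta>\<close> or
  more outside the ball only \<open>z\<close> with \<open>\<eta> \<le> norm z\<close> count; for
  \<open>x\<close> equally deep inside only such \<open>z\<close> can be lost. Both cases reduce to
  the Gaussian tail \<open>T\<close>.\<close>

lemma smoothed_ball_bounds:
  fixes x :: "'v::euclidean_space" and s \<eta> \<rho> :: real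
  assumes s: "0 < s" and \<eta>: "0 < \<eta>"
  defines "c \<equiv> sqrt (2 * pi * s\<^sup>2) ^ DIM('v)" and "\<tau> \<equiv> exp (- \<eta>\<^sup>2 / (4 * s\<^sup>2)) * sqrt 2 ^ DIM('v)"
  shows "0 \<le> smoothed_ball s \<rho> x" "smoothed_ball s \<rho> x \<le> c"
    and "\<rho> + \<eta> \<le> norm x \<Longrightarrow> smoothed_ball s \<rho> x \<le> \<tau> * c"
    and "norm x \<le> \<rho> - \<eta> \<Longrightarrow> (1 - \<tau>) * c \<le> smoothed_ball s \<rho> x"
proof -
  let ?g = "gauss s :: 'v \<Rightarrow> real"
  let ?I = "indicat_real (ball (0::'v) \<rho>)"
  have g: "integrable lborel ?g" "integral\<^sup>L lborel ?g = c"
    using has_bochner_integral_gauss[OF s, where 'v='v] by (auto simp: has_bochner_integral_iff c_def)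
  have eq: "smoothed_ball s \<rho> x = (\<integral>z. ?I (x + z) * ?g z \<partial>lborel)"
    unfolding smoothed_ball_def
    by (subst lborel_distr_plus[of x, symmetric], subst integral_distr) auto
  have int: "integrable lborel (\<lambda>z. ?I (x + z) * ?g z)"
    by (rule Bochner_Integration.integrable_bound[OF g(1)]) (auto split: split_indicator)
  show "0 \<le> smoothed_ball s \<rho> x"
    unfolding eq by (intro integral_nonneg_AE) auto
  show "smoothed_ball s \<rho> x \<le> c"
    unfolding eq g(2)[symmetric] by (intro integral_mono int g(1)) (auto split: split_indicator)
  define T where "T = (\<integral>z. indicat_real {z. \<eta> \<le> norm z} z * ?g z \<partial>lborel)"
  have intT: "integrable lborel (\<lambda>z. indicat_real {z. \<eta> \<le> norm z} z * ?g z)"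
    by (rule Bochner_Integration.integrable_bound[OF g(1)]) (auto split: split_indicator)
  \<comment> \<open>Half of the exponent yields the factor
    \<open>exp (- \<eta>\<^sup>2 / (4 * s\<^sup>2))\<close>; the other half is a Gaussian of width
    \<open>sqrt 2 * s\<close>, whose mass is \<open>sqrt 2 ^ DIM('v)\<close> times
    \<open>c\<close>.\<close>
  define s' where "s' = sqrt 2 * s"
  have s': "0 < s'" "s'\<^sup>2 = 2 * s\<^sup>2" using s by (auto simp: s'_def power_mult_distrib)
  have T: "T \<le> \<tau> * c"
  proof -
    have "indicat_real {z. \<eta> \<le> norm z} z * ?g z \<le> exp (- \<eta>\<^sup>2 / (4 * s\<^sup>2)) * gauss s' z" for z
    proof (cases "\<eta> \<le> norm z")
      case True
      then have "\<eta>\<^sup>2 \<le> (norm z)\<^sup>2" using \<eta> by (simp add: power_mono)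
      then have "- (norm z)\<^sup>2 / (2 * s\<^sup>2) \<le> - \<eta>\<^sup>2 / (4 * s\<^sup>2) + - (norm z)\<^sup>2 / (2 * s'\<^sup>2)"
        using s unfolding s' by (simp add: field_simps)
      then show ?thesis
        using True by (simp add: gauss_def flip: exp_add)
    qed simp
    then have "T \<le> (\<integral>z. exp (- \<eta>\<^sup>2 / (4 * s\<^sup>2)) * gauss s' (z::'v) \<partial>lborel)"
      unfolding T_def using has_bochner_integral_gauss[OF s'(1), where 'v='v]
      by (intro integral_mono intT) (auto simp: has_bochner_integral_iff)
    also have "\<dots> = exp (- \<eta>\<^sup>2 / (4 * s\<^sup>2)) * sqrt (2 * (2 * pi * s\<^sup>2)) ^ DIM('v)"
      using has_bochner_integral_gauss[OF s'(1), where 'v='v] s'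
      by (simp add: has_bochner_integral_iff mult_ac)
    also have "\<dots> = \<tau> * c"
      by (simp only: \<tau>_def c_def real_sqrt_mult power_mult_distrib mult_ac)
    finally show ?thesis .
  qed
  show "smoothed_ball s \<rho> x \<le> \<tau> * c" if "\<rho> + \<eta> \<le> norm x"
  proof -
    have "\<eta> \<le> norm z" if "norm (x + z) < \<rho>" for z
      using norm_triangle_ineq4[of "x + z" z] that \<open>\<rho> + \<eta> \<le> norm x\<close> by simp
    then have "smoothed_ball s \<rho> x \<le> T"
      unfolding eq T_def by (intro integral_mono int intT) (auto split: split_indicator)
    with T show ?thesis by simp
  qed
  show "(1 - \<tau>) * c \<le> smoothed_ball s \<rho> x" if "norm x \<le> \<rho> - \<eta>"
  proof -
    have "norm (x + z) < \<rho>" if "\<not> \<eta> \<le> norm z" for z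
      using norm_triangle_ineq[of x z] that \<open>norm x \<le> \<rho> - \<eta>\<close> by simp
    then have "?g z - indicat_real {z. \<eta> \<le> norm z} z * ?g z \<le> ?I (x + z) * ?g z" for z
      by (auto split: split_indicator)
    then have "c - T \<le> smoothed_ball s \<rho> x"
      unfolding eq T_def g(2)[symmetric]
      by (subst Bochner_Integration.integral_diff[symmetric]) (auto intro!: integral_mono int intT g(1))
    with T show ?thesis by (simp add: left_diff_distrib)
  qed
qed

text \<open>Test with a smoothed ball whose radius lies between \<open>r\<close> and
  \<open>r'\<close>, pass to the limit in \<open>k\<close>, and only then let the smoothing width
  \<open>s\<close> tend to 0. The gap between the radii makes the smoothing error
  \<open>\<tau> s\<close> vanish.\<close>

theorem char_convergence_tail:
  fixes \<mu> :: "nat \<Rightarrow> 'v::euclidean_space measure" and \<mu>' :: "'v measure"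
  assumes prob: "\<And>k. prob_space (\<mu> k)" and sets[measurable_cong]: "\<And>k. sets (\<mu> k) = sets borel"
    and prob': "prob_space \<mu>'" and sets'[measurable_cong]: "sets \<mu>' = sets borel"
    and conv: "\<And>t. (\<lambda>k. \<integral>x. iexp (t \<bullet> x) \<partial>\<mu> k) \<longlonglongrightarrow> (\<integral>x. iexp (t \<bullet> x) \<partial>\<mu>')"
    and r: "r < r'" and tail: "\<And>k. measure (\<mu> k) {x. r \<le> norm x} \<le> q"
  shows "measure \<mu>' {x. r' \<le> norm x} \<le> q"
proof -
  define \<rho> \<eta> where "\<rho> = (r + r') / 2" and "\<eta> = (r' - r) / 2"
  have \<eta>: "0 < \<eta>" "\<rho> - \<eta> = r" "\<rho> + \<eta> = r'" using r by (auto simp: \<rho>_def \<eta>_def field_simps)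
  interpret \<mu>': prob_space \<mu>' by (rule prob')
  let ?p = "measure \<mu>' {x. r' \<le> norm x}"
  define \<tau> where "\<tau> s = exp (- \<eta>\<^sup>2 / (4 * s\<^sup>2)) * sqrt 2 ^ DIM('v)" for s :: real
  define c where "c s = sqrt (2 * pi * s\<^sup>2) ^ DIM('v)" for s :: real
  have meas [measurable]: "smoothed_ball s \<rho> \<in> borel_measurable (borel :: 'v measure)" for s
    unfolding smoothed_ball_def by measurable
  \<comment> \<open>The left side comes from the mass at least \<open>1 - q\<close> that each
    \<open>\<mu> k\<close> gives to \<open>norm x < r\<close>, the right side from the limit law
    beyond \<open>r'\<close>; the common factor \<open>c s\<close> cancels.\<close>
  have key: "(1 - \<tau> s) * (1 - q) \<le> 1 - ?p + \<tau> s" if s: "0 < s" and \<tau>: "\<tau> s \<le> 1" for s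
  proof -
    have c: "0 < c s" using s by (simp add: c_def)
    have \<tau>0: "0 \<le> \<tau> s" by (simp add: \<tau>_def)
    note bounds = smoothed_ball_bounds[OF s \<eta>(1), where 'v='v and \<rho>=\<rho>, folded \<tau>_def c_def, unfolded \<eta>(2,3)]
    have int: "integrable \<zeta> (smoothed_ball s \<rho>)" if "prob_space \<zeta>" and [measurable_cong]: "sets \<zeta> = sets borel"
      for \<zeta> :: "'v measure"
      using bounds(1,2) that by (intro finite_measure.integrable_const_bound[where B="c s"]) (auto simp: prob_space_def)
    have "(1 - \<tau> s) * c s * (1 - q) \<le> (\<integral>x. smoothed_ball s \<rho> x \<partial>\<mu> k)" for k
    proof -
      interpret prob_space "\<mu> k" by (rule prob)
      have "1 - q \<le> prob {x \<in> space (\<mu> k). \<not> r \<le> norm x}"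
        using tail[of k] prob_neg[of "\<lambda>x. r \<le> norm x"] sets_eq_imp_space_eq[OF sets] by simp
      then have "(1 - \<tau> s) * c s * (1 - q) \<le> (1 - \<tau> s) * c s * prob {x \<in> space (\<mu> k). \<not> r \<le> norm x}"
        using \<tau> c by (intro mult_left_mono) auto
      also have "\<dots> = (\<integral>x. (1 - \<tau> s) * c s * indicat_real {x \<in> space (\<mu> k). \<not> r \<le> norm x} x \<partial>\<mu> k)"
        by simp
      also have "\<dots> \<le> (\<integral>x. smoothed_ball s \<rho> x \<partial>\<mu> k)"
        using bounds(1,4) by (intro integral_mono int prob sets) (auto split: split_indicator simp: emeasure_eq_measure)
      finally show ?thesis .
    qed
    then have "(1 - \<tau> s) * c s * (1 - q) \<le> (\<integral>x. smoothed_ball s \<rho> x \<partial>\<mu>')"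
      by (intro LIMSEQ_le_const[OF char_convergence_smoothed_ball[OF prob sets prob' sets' conv s]]) auto
    also have "\<dots> \<le> (\<integral>x. c s * (1 - indicat_real {x. r' \<le> norm x} x) + \<tau> s * c s * indicat_real {x. r' \<le> norm x} x \<partial>\<mu>')"
      using bounds(2,3) by (intro integral_mono int prob' sets') (auto split: split_indicator simp: \<mu>'.emeasure_eq_measure)
    also have "\<dots> = c s * (1 - ?p) + \<tau> s * c s * ?p"
      by (simp add: \<mu>'.emeasure_eq_measure \<mu>'.prob_space)
    also have "\<dots> \<le> c s * (1 - ?p) + \<tau> s * c s * 1"
      using \<tau>0 c by (intro add_left_mono mult_left_mono) auto
    finally have "c s * ((1 - \<tau> s) * (1 - q)) \<le> c s * (1 - ?p + \<tau> s)"
      by (simp add: algebra_simps)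
    with c show ?thesis by simp
  qed
  have lim: "(\<tau> \<longlongrightarrow> 0) (at_right 0)"
    unfolding \<tau>_def using \<eta> by real_asymp
  have "eventually (\<lambda>s. \<tau> s < 1) (at_right 0)"
    using order_tendstoD(2)[OF lim, of 1] by simp
  then have ev: "eventually (\<lambda>s. (1 - \<tau> s) * (1 - q) \<le> 1 - ?p + \<tau> s) (at_right 0)"
    using eventually_at_right_less[of 0] by eventually_elim (auto intro: key)
  have "((\<lambda>s. (1 - \<tau> s) * (1 - q)) \<longlongrightarrow> (1 - 0) * (1 - q)) (at_right 0)"
    "((\<lambda>s. 1 - ?p + \<tau> s) \<longlongrightarrow> 1 - ?p + 0) (at_right 0)"
    by (intro tendsto_mult tendsto_diff tendsto_add tendsto_const lim)+
  then have "(1 - 0) * (1 - q) \<le> 1 - ?p + 0"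
    using ev by (intro tendsto_le[of "at_right (0::real)"]) auto
  then show ?thesis by simp
qed

section \<open>Truncated sums of independent vectors\<close>

text \<open>On adding one coordinate, the cross term integrates to zero because \<open>Y\<close> has
  mean zero. Boundedness supplies all integrability.\<close>

lemma second_moment_iid_sum:
  fixes Y :: "'a \<Rightarrow> 'v::euclidean_space"
  assumes \<mu>: "prob_space \<mu>" and Y [measurable]: "Y \<in> borel_measurable \<mu>" and B: "\<And>u. norm (Y u) \<le> B"
    and mean: "integral\<^sup>L \<mu> Y = 0" and I: "finite I"
  shows "(\<integral>x. (norm (\<Sum>i\<in>I. Y (x i)))\<^sup>2 \<partial>PiM I (\<lambda>_. \<mu>)) = card I * (\<integral>u. (norm (Y u))\<^sup>2 \<partial>\<mu>)"
  using I
proof (induction I rule: finite_induct)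
  case empty
  then show ?case by simp
next
  case (insert i I)
  interpret \<mu>: prob_space \<mu> by fact
  interpret P: product_prob_space "\<lambda>_. \<mu>" UNIV ..
  interpret I: prob_space "PiM I (\<lambda>_. \<mu>)" by (intro prob_space_PiM \<mu>)
  have int: "integrable (PiM J (\<lambda>_. \<mu>)) (\<lambda>x. (norm (\<Sum>i\<in>J. Y (x i)))\<^sup>2)" if "finite J" for J :: "'b set"
  proof -
    interpret J: prob_space "PiM J (\<lambda>_. \<mu>)" by (intro prob_space_PiM \<mu>)
    have "norm (\<Sum>i\<in>J. Y (x i)) \<le> card J * B" for x
      by (intro order.trans[OF norm_sum] sum_bounded_above B)
    then show ?thesis
      by (intro J.integrable_const_bound[where B="(card J * B)\<^sup>2"]) (auto intro!: power_mono)
  qed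
  have intY: "integrable \<mu> Y" "integrable \<mu> (\<lambda>u. (norm (Y u))\<^sup>2)"
    using B by (intro \<mu>.integrable_const_bound[where B=B] \<mu>.integrable_const_bound[where B="B\<^sup>2"]; force intro: power_mono)+
  have "(\<integral>x. (norm (\<Sum>i\<in>insert i I. Y (x i)))\<^sup>2 \<partial>PiM (insert i I) (\<lambda>_. \<mu>)) =
    (\<integral>x. (\<integral>y. (norm (Y y + (\<Sum>j\<in>I. Y (x j))))\<^sup>2 \<partial>\<mu>) \<partial>PiM I (\<lambda>_. \<mu>))"
    using insert(1,2) int[of "insert i I"]
    by (subst P.product_integral_insert) (auto intro!: Bochner_Integration.integral_cong sum.cong arg_cong[where f="\<lambda>s. (norm (_ + s))\<^sup>2"])
  also have "\<dots> = (\<integral>x. (\<integral>u. (norm (Y u))\<^sup>2 \<partial>\<mu>) + (norm (\<Sum>j\<in>I. Y (x j)))\<^sup>2 \<partial>PiM I (\<lambda>_. \<mu>))"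
  proof (intro Bochner_Integration.integral_cong refl)
    fix x
    show "(\<integral>y. (norm (Y y + (\<Sum>j\<in>I. Y (x j))))\<^sup>2 \<partial>\<mu>) = (\<integral>u. (norm (Y u))\<^sup>2 \<partial>\<mu>) + (norm (\<Sum>j\<in>I. Y (x j)))\<^sup>2"
      using intY by (simp add: dot_norm[symmetric] power2_norm_eq_inner inner_add_left inner_add_right
         inner_commute[of "sum _ _" "Y _"] \<mu>.prob_space mean)
  qed
  also have "\<dots> = (\<integral>u. (norm (Y u))\<^sup>2 \<partial>\<mu>) + card I * (\<integral>u. (norm (Y u))\<^sup>2 \<partial>\<mu>)"
    using int[OF insert(1)] insert(3) by (simp add: I.prob_space)
  finally show ?case
    using insert(1,2) by (simp add: algebra_simps)
qed

text \<open>Large and small summands are treated separately: a union bound for some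
  \<open>x i\<close> of norm above \<open>R\<close>, Chebyshev for the sum of the truncated vectors.
  The centre \<open>c\<close> is the truncated mean, which makes these centred.\<close>

lemma iid_sum_tail:
  fixes \<mu> :: "'v::euclidean_space measure" and n :: nat
  assumes \<mu>: "prob_space \<mu>" and sets [measurable_cong]: "sets \<mu> = sets borel" and \<rho>: "0 < \<rho>" and R: "0 < R"
  defines "P \<equiv> PiM {..<n} (\<lambda>_. \<mu>)" and "c \<equiv> \<integral>u. indicat_real {u. norm u \<le> R} u *\<^sub>R u \<partial>\<mu>"
  shows "measure P {x \<in> space P. \<rho> \<le> norm ((\<Sum>i<n. x i) - real n *\<^sub>R c)} \<le>
    n * measure \<mu> {u. R < norm u} + n * (\<integral>u. indicat_real {u. norm u \<le> R} u * (norm u)\<^sup>2 \<partial>\<mu>) / \<rho>\<^sup>2"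
proof -
  interpret \<mu>: prob_space \<mu> by fact
  interpret P: product_prob_space "\<lambda>_. \<mu>" "{..<n}" ..
  interpret P: prob_space P unfolding P_def by (intro prob_space_PiM \<mu>)
  have P_cong [measurable_cong]: "sets P = sets (PiM {..<n} (\<lambda>_. \<mu>))" by (simp add: P_def)
  define T where "T u = indicat_real {u. norm u \<le> R} u *\<^sub>R u" for u :: 'v
  have T [measurable]: "T \<in> borel_measurable borel" unfolding T_def by measurable
  have TB: "norm (T u) \<le> R" for u using R by (auto simp: T_def split: split_indicator)
  have intT: "integrable \<mu> T"
    by (rule \<mu>.integrable_const_bound[where B=R]) (auto simp: TB)
  have intT2: "integrable \<mu> (\<lambda>u. (norm (T u))\<^sup>2)"
    by (rule \<mu>.integrable_const_bound[where B="R\<^sup>2"]) (auto simp: TB power_mono)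
  have c: "c = integral\<^sup>L \<mu> T" by (simp add: c_def T_def[abs_def])
  define Y where "Y u = T u - c" for u
  have Y [measurable]: "Y \<in> borel_measurable borel" unfolding Y_def by measurable
  have YB: "norm (Y u) \<le> R + norm c" for u
    unfolding Y_def using TB[of u] norm_triangle_ineq4[of "T u" c] by linarith
  define bad where "bad i = {x \<in> space P. R < norm (x i)}" for i
  define dev where "dev = {x \<in> space P. \<rho> \<le> norm (\<Sum>i<n. Y (x i))}"
  have [measurable]: "bad i \<in> sets P" if "i < n" for i
  proof -
    have [measurable]: "(\<lambda>x. x i) \<in> borel_measurable P"
      using measurable_component_singleton[of i "{..<n}" "\<lambda>_. \<mu>"] that
      by (simp add: P_def measurable_cong_sets[OF refl sets])
    show ?thesis unfolding bad_def by measurable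
  qed
  have [measurable]: "dev \<in> sets P"
    unfolding dev_def by measurable
  \<comment> \<open>When no coordinate is large, truncation changes nothing and the event becomes
    \<open>dev\<close>.\<close>
  have "{x \<in> space P. \<rho> \<le> norm ((\<Sum>i<n. x i) - real n *\<^sub>R c)} \<subseteq> (\<Union>i<n. bad i) \<union> dev"
  proof
    fix x assume x: "x \<in> {x \<in> space P. \<rho> \<le> norm ((\<Sum>i<n. x i) - real n *\<^sub>R c)}"
    have "(\<Sum>i<n. Y (x i)) = (\<Sum>i<n. x i) - real n *\<^sub>R c" if "\<forall>i<n. norm (x i) \<le> R"
      using that by (simp add: Y_def T_def sum_subtractf scaleR_conv_of_real sum_constant_scaleR)
    with x show "x \<in> (\<Union>i<n. bad i) \<union> dev"
      by (cases "\<forall>i<n. norm (x i) \<le> R") (auto simp: bad_def dev_def not_le)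
  qed
  then have "measure P {x \<in> space P. \<rho> \<le> norm ((\<Sum>i<n. x i) - real n *\<^sub>R c)} \<le> measure P ((\<Union>i<n. bad i) \<union> dev)"
    by (intro P.finite_measure_mono) auto
  also have "\<dots> \<le> measure P (\<Union>i<n. bad i) + measure P dev"
    by (intro measure_Un_le) auto
  also have "measure P (\<Union>i<n. bad i) \<le> (\<Sum>i<n. measure P (bad i))"
    by (intro P.finite_measure_subadditive_finite) auto
  also have "\<dots> = n * measure \<mu> {u. R < norm u}"
  proof -
    have "measure P (bad i) = measure \<mu> {u. R < norm u}" if "i < n" for i
    proof -
      have "measure \<mu> {u. R < norm u} = measure (distr P \<mu> (\<lambda>x. x i)) {u. R < norm u}"
        using that P.PiM_component[of i] by (simp add: P_def)
      also have "\<dots> = measure P (bad i)"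
        using that by (subst measure_distr) (auto simp: bad_def intro!: arg_cong[where f="measure P"])
      finally show ?thesis by simp
    qed
    then show ?thesis by simp
  qed
  also have "measure P dev \<le> n * (\<integral>u. indicat_real {u. norm u \<le> R} u * (norm u)\<^sup>2 \<partial>\<mu>) / \<rho>\<^sup>2"
  proof -
    have bound: "norm (\<Sum>i<n. Y (x i)) \<le> n * (R + norm c)" for x
      using sum_bounded_above[of "{..<n}" "\<lambda>i. norm (Y (x i))" "R + norm c"] YB
      by (intro order.trans[OF norm_sum]) auto
    \<comment> \<open>Variance is second moment minus squared mean; the squared mean is then
      dropped.\<close>
    have "(\<integral>u. (norm (Y u))\<^sup>2 \<partial>\<mu>) = (\<integral>u. (norm (T u))\<^sup>2 - 2 * (T u \<bullet> c) + (norm c)\<^sup>2 \<partial>\<mu>)"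
      by (simp add: Y_def power2_norm_eq_inner inner_commute algebra_simps)
    also have "\<dots> = (\<integral>u. (norm (T u))\<^sup>2 \<partial>\<mu>) - (norm c)\<^sup>2"
      using intT intT2 by (simp add: \<mu>.prob_space c power2_norm_eq_inner)
    also have "\<dots> \<le> (\<integral>u. (norm (T u))\<^sup>2 \<partial>\<mu>)" by simp
    also have "(\<lambda>u. (norm (T u))\<^sup>2) = (\<lambda>u. indicat_real {u. norm u \<le> R} u * (norm u)\<^sup>2)"
      by (auto simp: T_def split: split_indicator)
    finally have sec: "(\<integral>u. (norm (Y u))\<^sup>2 \<partial>\<mu>) \<le> (\<integral>u. indicat_real {u. norm u \<le> R} u * (norm u)\<^sup>2 \<partial>\<mu>)" .
    have "measure P dev * \<rho>\<^sup>2 = (\<integral>x. indicat_real dev x * \<rho>\<^sup>2 \<partial>P)"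
      by simp
    also have "\<dots> \<le> (\<integral>x. (norm (\<Sum>i<n. Y (x i)))\<^sup>2 \<partial>P)"
    proof (intro integral_mono)
      show "integrable P (\<lambda>x. (norm (\<Sum>i<n. Y (x i)))\<^sup>2)"
        by (intro P.integrable_const_bound[where B="(n * (R + norm c))\<^sup>2"]) (auto intro!: power_mono bound)
      show "indicat_real dev x * \<rho>\<^sup>2 \<le> (norm (\<Sum>i<n. Y (x i)))\<^sup>2" for x
        using \<rho> by (auto simp: dev_def power_mono split: split_indicator)
    qed (simp add: P.emeasure_eq_measure)
    also have "\<dots> = n * (\<integral>u. (norm (Y u))\<^sup>2 \<partial>\<mu>)"
      unfolding P_def using intT YB
      by (subst second_moment_iid_sum[OF \<mu>, where B="R + norm c"]) (auto simp: Y_def[abs_def] c \<mu>.prob_space)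
    also have "\<dots> \<le> n * (\<integral>u. indicat_real {u. norm u \<le> R} u * (norm u)\<^sup>2 \<partial>\<mu>)"
      by (intro mult_left_mono sec) simp
    finally show ?thesis
      using \<rho> by (simp add: field_simps)
  qed
  finally show ?thesis by simp
qed

text \<open>
  The law \<open>(1 - \<nu> S / n) \<delta>\<^sub>0 + \<nu>|\<^sub>S / n\<close>. The null case is separate because \<open>uniform_measure \<nu> S\<close>
  is a probability measure only for \<open>\<nu> S \<noteq> 0\<close>.
\<close>

definition thinned_law :: "'v::euclidean_space measure \<Rightarrow> 'v set \<Rightarrow> nat \<Rightarrow> 'v measure" where
  "thinned_law \<nu> S n = (if measure \<nu> S = 0 then return borel 0 else
     distr (measure_pmf (bernoulli_pmf (measure \<nu> S / n)) \<Otimes>\<^sub>M uniform_measure \<nu> S) borel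
       (\<lambda>(b, u). if b then u else 0))"

lemma sets_thinned_law [simp, measurable_cong]: "sets (thinned_law \<nu> S n) = sets borel"
  by (simp add: thinned_law_def)

text \<open>A coin with success probability \<open>measure \<nu> S / n\<close> decides whether a
  jump from the normalised restriction of \<open>\<nu>\<close> occurs; this needs
  \<open>measure \<nu> S \<le> real n\<close>. The factor \<open>1 / n\<close> in the expectation
  formula later cancels against the number of summands.\<close>

lemma
  fixes \<nu> :: "'v::euclidean_space measure"
  assumes sets [measurable_cong]: "sets \<nu> = sets borel" and S [measurable]: "S \<in> sets borel"
    and fin: "emeasure \<nu> S < \<infinity>" and n: "0 < n" "measure \<nu> S \<le> real n"
  shows prob_space_thinned_law: "prob_space (thinned_law \<nu> S n)" (is ?prob)
    and integral_thinned_law: "\<And>g :: 'v \<Rightarrow> 'b::{banach, second_countable_topology}.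
      g \<in> borel_measurable borel \<Longrightarrow> (\<And>u. norm (g u) \<le> B) \<Longrightarrow>
      integral\<^sup>L (thinned_law \<nu> S n) g = g 0 + (\<integral>u. indicat_real S u *\<^sub>R (g u - g 0) \<partial>\<nu>) /\<^sub>R n"
proof -
  have "?prob \<and> (\<forall>g :: 'v \<Rightarrow> 'b. g \<in> borel_measurable borel \<longrightarrow> (\<forall>u. norm (g u) \<le> B) \<longrightarrow>
      integral\<^sup>L (thinned_law \<nu> S n) g = g 0 + (\<integral>u. indicat_real S u *\<^sub>R (g u - g 0) \<partial>\<nu>) /\<^sub>R n)"
  proof (cases "measure \<nu> S = 0")
    case True
    then have "emeasure \<nu> S = 0"
      using fin by (auto simp: measure_def enn2real_eq_0_iff)
    then have "AE u in \<nu>. u \<notin> S"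
      by (intro AE_not_in) (auto simp: null_sets_def sets)
    then have "(\<integral>u. indicat_real S u *\<^sub>R (g u - g 0) \<partial>\<nu>) = 0" for g :: "'v \<Rightarrow> 'b"
      by (intro integral_eq_zero_AE) (auto elim!: eventually_mono)
    with True show ?thesis
      by (auto simp: thinned_law_def integral_return intro!: prob_space_return)
  next
    case False
    define m where "m = measure \<nu> S"
    have m: "0 < m" "emeasure \<nu> S = ennreal m"
      using False fin by (auto simp: m_def less_le emeasure_eq_ennreal_measure)
    define p where "p = m / n"
    have p: "0 \<le> p" "p \<le> 1" using m n by (auto simp: p_def m_def)
    interpret U: prob_space "uniform_measure \<nu> S"
      using m by (intro prob_space_uniform_measure) auto
    interpret pair_prob_space "measure_pmf (bernoulli_pmf p)" "uniform_measure \<nu> S" ..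
    let ?h = "\<lambda>(b, u). if b then u else (0::'v)"
    have h: "?h \<in> measurable (measure_pmf (bernoulli_pmf p) \<Otimes>\<^sub>M uniform_measure \<nu> S) borel"
      by measurable
    have law: "thinned_law \<nu> S n = distr (measure_pmf (bernoulli_pmf p) \<Otimes>\<^sub>M uniform_measure \<nu> S) borel ?h"
      using False by (simp add: thinned_law_def p_def m_def)
    have "integral\<^sup>L (thinned_law \<nu> S n) g = g 0 + (\<integral>u. indicat_real S u *\<^sub>R (g u - g 0) \<partial>\<nu>) /\<^sub>R n"
      if [measurable]: "g \<in> borel_measurable borel" and B: "\<And>u. norm (g u) \<le> B" for g :: "'v \<Rightarrow> 'b"
    proof -
      have "integral\<^sup>L (thinned_law \<nu> S n) g =
        (\<integral>z. g (?h z) \<partial>(measure_pmf (bernoulli_pmf p) \<Otimes>\<^sub>M uniform_measure \<nu> S))"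
        unfolding law using h by (simp add: integral_distr)
      also have "\<dots> = (\<integral>b. (\<integral>u. g (?h (b, u)) \<partial>uniform_measure \<nu> S) \<partial>bernoulli_pmf p)"
        using h by (intro integral_fst'[symmetric] P.integrable_const_bound[where B=B]) (auto simp: B)
      \<comment> \<open>Average over the coin; the normalising mass \<open>m\<close> of
        \<open>uniform_measure\<close> then cancels with the \<open>m\<close> in
        \<open>p = m / n\<close>.\<close>
      also have "\<dots> = p *\<^sub>R (\<integral>u. g u \<partial>uniform_measure \<nu> S) + (1 - p) *\<^sub>R g 0"
        using p U.prob_space by (subst integral_measure_pmf[where A=UNIV]) (auto simp: UNIV_bool)
      also have "\<dots> = g 0 + p *\<^sub>R (\<integral>u. g u - g 0 \<partial>uniform_measure \<nu> S)"
        using U.prob_space by (subst Bochner_Integration.integral_diff)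
           (auto simp: scaleR_diff_left scaleR_diff_right intro!: U.integrable_const_bound[where B=B] B)
      also have "(\<integral>u. g u - g 0 \<partial>uniform_measure \<nu> S) = (\<integral>u. indicat_real S u *\<^sub>R (g u - g 0) \<partial>\<nu>) /\<^sub>R m"
      proof -
        have "uniform_measure \<nu> S = density \<nu> (\<lambda>u. ennreal (indicat_real S u / m))"
          unfolding uniform_measure_def m(2) using m(1)
          by (intro arg_cong[where f="density \<nu>"] ext) (auto split: split_indicator simp: divide_ennreal[symmetric])
        then have "(\<integral>u. g u - g 0 \<partial>uniform_measure \<nu> S) = (\<integral>u. (indicat_real S u / m) *\<^sub>R (g u - g 0) \<partial>\<nu>)"
          using m by (simp add: integral_density)
        also have "\<dots> = (\<integral>u. (1 / m) *\<^sub>R (indicat_real S u *\<^sub>R (g u - g 0)) \<partial>\<nu>)"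
          by (intro Bochner_Integration.integral_cong) auto
        also have "\<dots> = (1 / m) *\<^sub>R (\<integral>u. indicat_real S u *\<^sub>R (g u - g 0) \<partial>\<nu>)"
          by (rule integral_scaleR_right)
        finally show ?thesis by (simp only: divide_inverse mult_1_left)
      qed
      finally show ?thesis
        using m by (simp add: p_def field_simps)
    qed
    moreover have ?prob
      unfolding law using h by (rule P.prob_space_distr)
    ultimately show ?thesis by blast
  qed
  then show ?prob "\<And>g :: 'v \<Rightarrow> 'b. g \<in> borel_measurable borel \<Longrightarrow> (\<And>u. norm (g u) \<le> B) \<Longrightarrow>
      integral\<^sup>L (thinned_law \<nu> S n) g = g 0 + (\<integral>u. indicat_real S u *\<^sub>R (g u - g 0) \<partial>\<nu>) /\<^sub>R n"
    by blast+
qed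

section \<open>Tails of infinitely divisible vectors\<close>

text \<open>Integrability of the minimum of 1 and \<open>(norm u)\<^sup>2\<close>, split at an
  arbitrary radius because the jumps are cut at \<open>R\<close> and not only at 1.\<close>

locale levy_measure =
  fixes \<nu> :: "'v::euclidean_space measure"
  assumes sets_levy [measurable_cong]: "sets \<nu> = sets borel"
    and tail_finite: "0 < r \<Longrightarrow> emeasure \<nu> {u. r < norm u} < \<infinity>"
    and truncated_sq_integrable: "0 < r \<Longrightarrow> integrable \<nu> (\<lambda>u. indicat_real {u. norm u \<le> r} u * (norm u)\<^sup>2)"

text \<open>The integrand of \<open>levy_khintchine\<close> with a free compensation cutoff, so that
  it can match the level at which jumps are truncated.\<close>

definition levy_kernel :: "real \<Rightarrow> 'v::euclidean_space \<Rightarrow> 'v \<Rightarrow> complex" where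
  "levy_kernel R t u = iexp (t \<bullet> u) - 1 - \<i> * complex_of_real (t \<bullet> u) * of_bool (norm u \<le> R)"

lemma levy_kernel_measurable [measurable]: "levy_kernel R t \<in> borel_measurable borel"
  unfolding levy_kernel_def of_bool_def by measurable

text \<open>Second-order Taylor bound where the kernel is compensated, the trivial bound 2
  elsewhere. The right side is the integrable majorant for dominated convergence.\<close>

lemma norm_levy_kernel:
  "norm (levy_kernel R t u) \<le> (norm t)\<^sup>2 * (indicat_real {u. norm u \<le> R} u * (norm u)\<^sup>2) + 2 * indicat_real {u. R < norm u} u"
proof (cases "norm u \<le> R")
  case True
  have "norm (levy_kernel R t u) \<le> \<bar>t \<bullet> u\<bar>\<^sup>2 / 2"
    using iexp_approx1[of "t \<bullet> u" 1] True by (simp add: levy_kernel_def numeral_2_eq_2 algebra_simps)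
  also have "\<dots> \<le> \<bar>t \<bullet> u\<bar>\<^sup>2" by simp
  also have "\<dots> \<le> (norm t * norm u)\<^sup>2"
    by (intro power_mono Cauchy_Schwarz_ineq2) auto
  finally show ?thesis using True by (simp add: power_mult_distrib)
next
  case False
  then show ?thesis
    using norm_triangle_ineq4[of "iexp (t \<bullet> u)" 1] by (simp add: levy_kernel_def)
qed

context levy_measure
begin

lemma integrable_tail_indicator: "0 < r \<Longrightarrow> integrable \<nu> (indicat_real {u. r < norm u})"
  using tail_finite by (intro integrable_real_indicator) auto

lemma integrable_kernel_bound:
  assumes "0 < R"
  shows "integrable \<nu> (\<lambda>u. (norm t)\<^sup>2 * (indicat_real {u. norm u \<le> R} u * (norm u)\<^sup>2) + 2 * indicat_real {u. R < norm u} u)"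
  using assms by (intro Bochner_Integration.integrable_add integrable_mult_right truncated_sq_integrable integrable_tail_indicator)

lemma integrable_levy_kernel: "0 < R \<Longrightarrow> integrable \<nu> (levy_kernel R t)"
  by (rule Bochner_Integration.integrable_bound[OF integrable_kernel_bound[of R t]])
    (auto intro: order.trans[OF norm_levy_kernel])

text \<open>Two cutoffs differ only on an annulus bounded away from 0, where \<open>\<nu>\<close> is
  finite and \<open>u\<close> is bounded. Changing the cutoff therefore only changes the
  drift.\<close>

lemma recentre:
  assumes "0 < R" "0 < R'"
  shows "\<exists>c. \<forall>t. integral\<^sup>L \<nu> (levy_kernel R' t) = integral\<^sup>L \<nu> (levy_kernel R t) + \<i> * complex_of_real (t \<bullet> c)"
proof -
  define h where "h u = (of_bool (norm u \<le> R) - of_bool (norm u \<le> R') :: real) *\<^sub>R u" for u :: 'v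
  have [measurable]: "h \<in> borel_measurable borel"
    unfolding h_def of_bool_def by measurable
  have h: "integrable \<nu> h"
  proof (rule Bochner_Integration.integrable_bound)
    show "integrable \<nu> (\<lambda>u. max R R' * indicat_real {u. min R R' < norm u} u)"
      using assms by (intro integrable_mult_right integrable_tail_indicator) auto
    show "AE u in \<nu>. norm (h u) \<le> norm (max R R' * indicat_real {u. min R R' < norm u} u)"
      by (intro AE_I2) (auto simp: h_def indicator_def)
  qed auto
  have "integral\<^sup>L \<nu> (levy_kernel R' t) = integral\<^sup>L \<nu> (levy_kernel R t) + \<i> * complex_of_real (t \<bullet> integral\<^sup>L \<nu> h)" for t
  proof -
    have *: "integrable \<nu> (\<lambda>u. \<i> * complex_of_real (t \<bullet> h u))"
      using h by (intro integrable_mult_right integrable_of_real integrable_inner_right) auto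
    have "levy_kernel R' t = (\<lambda>u. levy_kernel R t u + \<i> * complex_of_real (t \<bullet> h u))"
      by (auto simp: fun_eq_iff levy_kernel_def h_def algebra_simps)
    then have "integral\<^sup>L \<nu> (levy_kernel R' t) = integral\<^sup>L \<nu> (levy_kernel R t) + (\<integral>u. \<i> * complex_of_real (t \<bullet> h u) \<partial>\<nu>)"
      by (simp only:) (intro Bochner_Integration.integral_add integrable_levy_kernel assms(1) *)
    also have "(\<integral>u. \<i> * complex_of_real (t \<bullet> h u) \<partial>\<nu>) = \<i> * complex_of_real (t \<bullet> integral\<^sup>L \<nu> h)"
      using h by simp
    finally show ?thesis .
  qed
  then show ?thesis by blast
qed

text \<open>The law is that of a sum of \<open>n\<close> independent thinned jumps, recentred by a
  constant. Its characteristic function is a phase times \<open>(1 + z) ^ n\<close>, close to the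
  compound Poisson exponential uniformly in \<open>t\<close>, while \<open>iid_sum_tail\<close>
  bounds its tail by quantities free of \<open>n\<close> and \<open>\<epsilon>\<close>.\<close>

lemma iid_row_approximation:
  assumes R: "0 < R" and \<epsilon>: "0 < \<epsilon>" and e: "0 < e" and r: "0 < r"
  obtains \<mu> where "prob_space \<mu>" "sets \<mu> = sets borel"
    "\<And>t. norm ((\<integral>x. iexp (t \<bullet> x) \<partial>\<mu>) - exp (\<integral>u. indicat_real {u. \<epsilon> < norm u} u *\<^sub>R levy_kernel R t u \<partial>\<nu>)) \<le> e"
    "measure \<mu> {x. r \<le> norm x} \<le>
      measure \<nu> {u. R < norm u} + (\<integral>u. indicat_real {u. norm u \<le> R} u * (norm u)\<^sup>2 \<partial>\<nu>) / r\<^sup>2"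
proof -
  define S where "S = {u::'v. \<epsilon> < norm u}"
  have S [measurable]: "S \<in> sets borel" by (simp add: S_def)
  have S_fin: "emeasure \<nu> S < \<infinity>" unfolding S_def by (rule tail_finite[OF \<epsilon>])
  have intS: "integrable \<nu> (indicat_real S)" unfolding S_def by (rule integrable_tail_indicator[OF \<epsilon>])
  define m where "m = measure \<nu> S"
  define C where "C = exp 2 * (2 * m)\<^sup>2"
  \<comment> \<open>Three demands: at least one summand, \<open>m \<le> n\<close> so that the
    thinned law exists, and \<open>C / n \<le> e\<close>, where \<open>C / n\<close> is the final
    error from the Taylor remainder of \<open>exp\<close>.\<close>
  define n where "n = nat \<lceil>max 1 (max m (C / e))\<rceil>"
  have "max 1 (max m (C / e)) \<le> real n"
    unfolding n_def by linarith
  then have n: "1 \<le> real n" "m \<le> real n" "C / e \<le> real n" by auto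
  then have n0: "0 < n" by simp
  define \<theta> where "\<theta> = thinned_law \<nu> S n"
  interpret \<theta>: prob_space \<theta>
    unfolding \<theta>_def by (rule prob_space_thinned_law[OF sets_levy S S_fin n0]) (use n in \<open>simp add: m_def\<close>)
  have sets_\<theta> [measurable_cong]: "sets \<theta> = sets borel" by (simp add: \<theta>_def)
  note law = integral_thinned_law[OF sets_levy S S_fin n0, folded \<theta>_def m_def, OF n(2)]
  have bdd_int: "integrable \<nu> (\<lambda>u. indicat_real S u *\<^sub>R g u)" if "g \<in> borel_measurable borel" "\<And>u. norm (g u) \<le> B"
    for g :: "'v \<Rightarrow> 'c::{banach, second_countable_topology}" and B
  proof (rule Bochner_Integration.integrable_bound)
    show "integrable \<nu> (\<lambda>u. B * indicat_real S u)" using intS by simp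
    show "(\<lambda>u. indicat_real S u *\<^sub>R g u) \<in> borel_measurable \<nu>" using that(1) by measurable
    show "AE u in \<nu>. norm (indicat_real S u *\<^sub>R g u) \<le> norm (B * indicat_real S u)"
      using that(2) order.trans[OF that(2) abs_ge_self] by (intro AE_I2) (auto simp: indicator_def)
  qed
  define T where "T u = indicat_real {u. norm u \<le> R} u *\<^sub>R u" for u :: 'v
  have T [measurable]: "T \<in> borel_measurable borel" unfolding T_def by measurable
  have TB: "norm (T u) \<le> R" for u using R by (auto simp: T_def indicator_def)
  define c where "c = integral\<^sup>L \<theta> T"
  define d where "d = (\<integral>u. indicat_real S u *\<^sub>R T u \<partial>\<nu>)"
  \<comment> \<open>As \<open>T 0 = 0\<close>, the truncated mean of \<open>\<theta>\<close> is
    \<open>d / n\<close>; the total centring \<open>d\<close> is thus independent of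
    \<open>n\<close>.\<close>
  have nc: "real n *\<^sub>R c = d"
    unfolding c_def d_def using n0 by (subst law[OF T TB]) (simp add: T_def)
  define P where "P = PiM {..<n} (\<lambda>_. \<theta>)"
  interpret PP: product_prob_space "\<lambda>_. \<theta>" "{..<n}" ..
  interpret P: prob_space P unfolding P_def by (intro prob_space_PiM) unfold_locales
  define Z where "Z x = (\<Sum>i<n. x i) - real n *\<^sub>R c" for x :: "nat \<Rightarrow> 'v"
  have Z: "Z \<in> measurable P borel"
    unfolding Z_def P_def by measurable
  show ?thesis
  proof (rule that[of "distr P borel Z"])
    show "prob_space (distr P borel Z)" using Z by (rule P.prob_space_distr)
    show "sets (distr P borel Z) = sets borel" by simp
    have "measure (distr P borel Z) {x. r \<le> norm x} = measure P {x \<in> space P. r \<le> norm (Z x)}"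
      using Z by (subst measure_distr) (auto intro!: arg_cong[where f="measure P"])
    also have "\<dots> \<le> n * measure \<theta> {u. R < norm u} + n * (\<integral>u. indicat_real {u. norm u \<le> R} u * (norm u)\<^sup>2 \<partial>\<theta>) / r\<^sup>2"
      unfolding Z_def P_def c_def T_def by (rule iid_sum_tail[OF \<theta>.prob_space_axioms sets_\<theta> r R])
    \<comment> \<open>The factor \<open>n\<close> cancels the \<open>1 / n\<close> from the thinned
      law, and removing the indicator of \<open>S\<close> only enlarges the integral. The second
      moment below is handled alike.\<close>
    also have "n * measure \<theta> {u. R < norm u} \<le> measure \<nu> {u. R < norm u}"
    proof -
      have B: "norm (indicat_real {u. R < norm u} u) \<le> 1" for u :: 'v
        by (simp add: indicator_def)
      have "measure \<theta> {u. R < norm u} = (\<integral>u. indicat_real {u. R < norm u} u \<partial>\<theta>)" by simp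
      also have "\<dots> = (\<integral>u. indicat_real S u *\<^sub>R indicat_real {u. R < norm u} u \<partial>\<nu>) /\<^sub>R n"
        using R by (subst law[OF _ B]) auto
      finally have "n * measure \<theta> {u. R < norm u} = (\<integral>u. indicat_real S u *\<^sub>R indicat_real {u. R < norm u} u \<partial>\<nu>)"
        using n0 by simp
      also have "\<dots> \<le> (\<integral>u. indicat_real {u. R < norm u} u \<partial>\<nu>)"
        by (intro integral_mono bdd_int[OF _ B] integrable_tail_indicator R) (auto simp: indicator_def)
      finally show ?thesis by simp
    qed
    also have "n * (\<integral>u. indicat_real {u. norm u \<le> R} u * (norm u)\<^sup>2 \<partial>\<theta>) \<le> (\<integral>u. indicat_real {u. norm u \<le> R} u * (norm u)\<^sup>2 \<partial>\<nu>)"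
    proof -
      have B: "norm (indicat_real {u. norm u \<le> R} u * (norm u)\<^sup>2) \<le> R\<^sup>2" for u :: 'v
        by (auto simp: indicator_def power_mono)
      have "n * (\<integral>u. indicat_real {u. norm u \<le> R} u * (norm u)\<^sup>2 \<partial>\<theta>) =
         (\<integral>u. indicat_real S u *\<^sub>R (indicat_real {u. norm u \<le> R} u * (norm u)\<^sup>2) \<partial>\<nu>)"
        using n0 by (subst law[OF _ B]) auto
      also have "\<dots> \<le> (\<integral>u. indicat_real {u. norm u \<le> R} u * (norm u)\<^sup>2 \<partial>\<nu>)"
        using B by (intro integral_mono bdd_int[OF _ B] truncated_sq_integrable R) (auto simp: indicator_def)
      finally show ?thesis .
    qed
    finally show "measure (distr P borel Z) {x. r \<le> norm x} \<le>
      measure \<nu> {u. R < norm u} + (\<integral>u. indicat_real {u. norm u \<le> R} u * (norm u)\<^sup>2 \<partial>\<nu>) / r\<^sup>2"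
      by (simp add: divide_right_mono)
    fix t :: 'v
    define a where "a = (\<integral>u. indicat_real S u *\<^sub>R (iexp (t \<bullet> u) - 1) \<partial>\<nu>)"
    define z where "z = a / n"
    have B2: "norm (iexp (t \<bullet> u) - 1) \<le> 2" for u
      using norm_triangle_ineq4[of "iexp (t \<bullet> u)" 1] by simp
    have int_a: "integrable \<nu> (\<lambda>u. indicat_real S u *\<^sub>R (iexp (t \<bullet> u) - 1))"
      by (intro bdd_int[OF _ B2]) measurable
    have char_\<theta>: "(\<integral>u. iexp (t \<bullet> u) \<partial>\<theta>) = 1 + z"
      by (subst law[of "\<lambda>u. iexp (t \<bullet> u)"]) (auto simp: z_def a_def scaleR_conv_of_real divide_inverse)
    have "(\<integral>x. iexp (t \<bullet> x) \<partial>distr P borel Z) = (\<integral>x. iexp (- (t \<bullet> d)) * (\<Prod>i<n. iexp (t \<bullet> x i)) \<partial>P)"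
      using Z by (simp add: integral_distr Z_def nc inner_diff_right inner_sum_right exp_diff exp_minus
          exp_sum sum_distrib_left right_diff_distrib divide_inverse)
    also have "\<dots> = iexp (- (t \<bullet> d)) * (1 + z) ^ n"
      unfolding P_def char_\<theta>[symmetric]
      by (subst integral_mult_right_zero, subst PP.product_integral_prod)
        (auto intro!: \<theta>.integrable_const_bound[where B=1])
    finally have char: "(\<integral>x. iexp (t \<bullet> x) \<partial>distr P borel Z) = iexp (- (t \<bullet> d)) * (1 + z) ^ n" .
    have "exp z ^ n = exp (of_nat n * z)"
      by (rule exp_of_nat_mult[symmetric])
    then have exp_z: "exp z ^ n = exp a"
      using n0 by (simp add: z_def)
    \<comment> \<open>On \<open>S\<close> the kernel integral splits into the uncompensated exponent
      \<open>a\<close> and the compensator, which is exactly the centring \<open>d\<close>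
      subtracted in \<open>Z\<close>.\<close>
    have "(\<integral>u. indicat_real S u *\<^sub>R levy_kernel R t u \<partial>\<nu>) = a - (\<integral>u. \<i> * complex_of_real (t \<bullet> (indicat_real S u *\<^sub>R T u)) \<partial>\<nu>)"
    proof -
      have int_d: "integrable \<nu> (\<lambda>u. \<i> * complex_of_real (t \<bullet> (indicat_real S u *\<^sub>R T u)))"
        by (intro integrable_mult_right integrable_of_real integrable_inner_right bdd_int[OF T TB])
      have "indicat_real S u *\<^sub>R levy_kernel R t u =
          indicat_real S u *\<^sub>R (iexp (t \<bullet> u) - 1) - \<i> * complex_of_real (t \<bullet> (indicat_real S u *\<^sub>R T u))" for u
        by (auto simp: levy_kernel_def T_def indicator_def)
      then show ?thesis
        unfolding a_def by (simp only: Bochner_Integration.integral_diff[OF int_a int_d])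
    qed
    also have "\<dots> = a - \<i> * complex_of_real (t \<bullet> d)"
      unfolding d_def by (simp only: integral_mult_right_zero integral_complex_of_real
          integral_inner_right[OF bdd_int[OF T TB]])
    finally have "exp (\<integral>u. indicat_real S u *\<^sub>R levy_kernel R t u \<partial>\<nu>) = iexp (- (t \<bullet> d)) * exp z ^ n"
      using exp_z by (simp add: exp_diff exp_minus divide_inverse)
    then have "norm ((\<integral>x. iexp (t \<bullet> x) \<partial>distr P borel Z) - exp (\<integral>u. indicat_real S u *\<^sub>R levy_kernel R t u \<partial>\<nu>)) =
      norm (iexp (- (t \<bullet> d)) * ((1 + z) ^ n - exp z ^ n))"
      unfolding char by (simp only: right_diff_distrib)
    also have "\<dots> = norm ((1 + z) ^ n - exp z ^ n)"
      by (simp only: norm_mult norm_exp_i_times mult_1_left)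
    \<comment> \<open>Comparing powers this way needs both bases in the closed unit disc:
      \<open>1 + z\<close> is a value of a characteristic function, and \<open>Re a \<le> 0\<close>
      because the cosine is at most 1.\<close>
    also have "\<dots> \<le> n * norm ((1 + z) - exp z)"
    proof (rule norm_power_diff)
      show "norm (1 + z) \<le> 1"
        unfolding char_\<theta>[symmetric]
        by (rule order.trans[OF integral_norm_bound]) (simp add: \<theta>.prob_space)
      have "Re a = (\<integral>u. Re (indicat_real S u *\<^sub>R (iexp (t \<bullet> u) - 1)) \<partial>\<nu>)"
        unfolding a_def by (rule integral_Re[OF int_a, symmetric])
      also have "\<dots> \<le> (\<integral>u. 0 \<partial>\<nu>)"
        by (intro integral_mono integrable_Re int_a) (auto simp: indicator_def Re_exp)
      finally have "Re a \<le> 0" by simp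
      then show "norm (exp z) \<le> 1"
        by (simp add: z_def divide_nonpos_nonneg)
    qed
    also have "\<dots> \<le> n * (C / n\<^sup>2)"
    proof (intro mult_left_mono)
      have "norm a \<le> (\<integral>u. 2 * indicat_real S u \<partial>\<nu>)"
        unfolding a_def using B2 intS
        by (intro Bochner_Integration.integral_norm_bound_integral int_a) (auto split: split_indicator)
      then have a: "norm a \<le> 2 * m" by (simp add: m_def S_fin less_top)
      then have z: "norm z \<le> 2 * m / n" by (simp add: z_def norm_divide divide_right_mono)
      also have "\<dots> \<le> 2" using n by (simp add: field_simps)
      finally have z2: "norm z \<le> 2" .
      have "norm ((1 + z) - exp z) \<le> exp (norm z) * (norm z)\<^sup>2"
        using Taylor_exp_field[of z 1] by (simp add: norm_minus_commute power2_eq_square)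
      also have "\<dots> \<le> exp 2 * (2 * m / n)\<^sup>2"
        using z z2 by (intro mult_mono power_mono) auto
      finally show "norm ((1 + z) - exp z) \<le> C / n\<^sup>2"
        by (simp add: C_def power_divide)
    qed simp
    also have "\<dots> = C / n" using n0 by (simp add: power2_eq_square)
    also have "\<dots> \<le> e" using n0 n(3) e by (simp add: field_simps)
    finally show "norm ((\<integral>x. iexp (t \<bullet> x) \<partial>distr P borel Z) - exp (\<integral>u. indicat_real {u. \<epsilon> < norm u} u *\<^sub>R levy_kernel R t u \<partial>\<nu>)) \<le> e"
      unfolding S_def .
  qed
qed

text \<open>
  The centre \<open>b\<close> is the mean of the part of \<open>X\<close> with jumps of size at most \<open>R\<close>; it depends only on \<open>R\<close>.
\<close>

theorem levy_tail:
  assumes M: "prob_space M" and X [measurable]: "X \<in> borel_measurable M" and LK: "levy_khintchine M X \<nu>"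
    and R: "0 < R" and r: "0 < r" "r < r'"
  obtains b where "measure M {w \<in> space M. r' \<le> norm (X w - b)} \<le>
    measure \<nu> {u. R < norm u} + (\<integral>u. indicat_real {u. norm u \<le> R} u * (norm u)\<^sup>2 \<partial>\<nu>) / r\<^sup>2"
proof -
  interpret M: prob_space M by fact
  obtain \<beta> where \<beta>: "\<And>t. (\<integral>w. iexp (t \<bullet> X w) \<partial>M) = exp (\<i> * complex_of_real (t \<bullet> \<beta>) + integral\<^sup>L \<nu> (levy_kernel 1 t))"
    using LK unfolding levy_khintchine_def levy_kernel_def by blast
  obtain c where c: "\<And>t. integral\<^sup>L \<nu> (levy_kernel 1 t) = integral\<^sup>L \<nu> (levy_kernel R t) + \<i> * complex_of_real (t \<bullet> c)"
    using recentre[OF R, of 1] by auto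
  \<comment> \<open>The drift of \<open>X\<close>, corrected for moving the compensation cutoff from
    1 to \<open>R\<close>.\<close>
  define b where "b = \<beta> + c"
  define \<mu>' where "\<mu>' = distr M borel (\<lambda>w. X w - b)"
  define q where "q = measure \<nu> {u. R < norm u} + (\<integral>u. indicat_real {u. norm u \<le> R} u * (norm u)\<^sup>2 \<partial>\<nu>) / r\<^sup>2"
  have char: "(\<integral>x. iexp (t \<bullet> x) \<partial>\<mu>') = exp (integral\<^sup>L \<nu> (levy_kernel R t))" for t
  proof -
    have "(\<integral>x. iexp (t \<bullet> x) \<partial>\<mu>') = (\<integral>w. iexp (t \<bullet> X w) * iexp (- (t \<bullet> b)) \<partial>M)"
      unfolding \<mu>'_def by (subst integral_distr) (auto simp: inner_diff_right right_diff_distrib exp_diff exp_minus divide_inverse)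
    also have "\<dots> = exp (\<i> * complex_of_real (t \<bullet> \<beta>) + (integral\<^sup>L \<nu> (levy_kernel R t) + \<i> * complex_of_real (t \<bullet> c))) * iexp (- (t \<bullet> b))"
      by (subst integral_mult_left_zero) (simp only: \<beta> c)
    also have "\<dots> = exp (integral\<^sup>L \<nu> (levy_kernel R t))"
      by (simp add: b_def algebra_simps flip: exp_add)
    finally show ?thesis .
  qed
  \<comment> \<open>One null sequence serves both as the level below which jumps are discarded and
    as the permitted error. The tail bound \<open>q\<close> is the same for all
    \<open>k\<close>.\<close>
  define \<epsilon> where "\<epsilon> k = 1 / (real k + 1)" for k
  have \<epsilon>: "0 < \<epsilon> k" for k by (simp add: \<epsilon>_def)
  have \<epsilon>_lim: "\<epsilon> \<longlonglongrightarrow> 0" unfolding \<epsilon>_def by real_asymp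
  define Q where "Q k \<mu> \<longleftrightarrow> prob_space \<mu> \<and> sets \<mu> = sets borel \<and>
    (\<forall>t. norm ((\<integral>x. iexp (t \<bullet> x) \<partial>\<mu>) - exp (\<integral>u. indicat_real {u. \<epsilon> k < norm u} u *\<^sub>R levy_kernel R t u \<partial>\<nu>)) \<le> \<epsilon> k) \<and>
    measure \<mu> {x. r \<le> norm x} \<le> q" for k \<mu>
  have "\<exists>\<mu>. Q k \<mu>" for k
  proof (rule iid_row_approximation[OF R \<epsilon>[of k] \<epsilon>[of k] r(1), folded q_def])
    fix \<mu> :: "'v measure"
    assume "prob_space \<mu>" "sets \<mu> = sets borel"
      "\<And>t. norm ((\<integral>x. iexp (t \<bullet> x) \<partial>\<mu>) - exp (\<integral>u. indicat_real {u. \<epsilon> k < norm u} u *\<^sub>R levy_kernel R t u \<partial>\<nu>)) \<le> \<epsilon> k"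
      "measure \<mu> {x. r \<le> norm x} \<le> q"
    then show ?thesis unfolding Q_def by (intro exI[of _ \<mu>] conjI allI)
  qed
  then obtain \<mu> where Q: "\<And>k. Q k (\<mu> k)"
    by metis
  have \<mu>: "prob_space (\<mu> k)" "sets (\<mu> k) = sets borel"
    "norm ((\<integral>x. iexp (t \<bullet> x) \<partial>\<mu> k) - exp (\<integral>u. indicat_real {u. \<epsilon> k < norm u} u *\<^sub>R levy_kernel R t u \<partial>\<nu>)) \<le> \<epsilon> k"
    "measure (\<mu> k) {x. r \<le> norm x} \<le> q" for k t
    using Q[of k] by (simp_all only: Q_def)
  have conv: "(\<lambda>k. \<integral>x. iexp (t \<bullet> x) \<partial>\<mu> k) \<longlonglongrightarrow> (\<integral>x. iexp (t \<bullet> x) \<partial>\<mu>')" for t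
  proof -
    \<comment> \<open>The discarded jumps shrink to \<open>u = 0\<close>, where the kernel
      vanishes.\<close>
    have "(\<lambda>k. \<integral>u. indicat_real {u. \<epsilon> k < norm u} u *\<^sub>R levy_kernel R t u \<partial>\<nu>) \<longlonglongrightarrow> integral\<^sup>L \<nu> (levy_kernel R t)"
    proof (rule integral_dominated_convergence[OF _ _ integrable_kernel_bound[OF R, of t]])
      show "AE u in \<nu>. (\<lambda>k. indicat_real {u. \<epsilon> k < norm u} u *\<^sub>R levy_kernel R t u) \<longlonglongrightarrow> levy_kernel R t u"
      proof (rule AE_I2)
        fix u
        show "(\<lambda>k. indicat_real {u. \<epsilon> k < norm u} u *\<^sub>R levy_kernel R t u) \<longlonglongrightarrow> levy_kernel R t u"
        proof (cases "u = 0")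
          case True
          then show ?thesis by (simp add: levy_kernel_def)
        next
          case False
          then have "eventually (\<lambda>k. \<epsilon> k < norm u) sequentially"
            using order_tendstoD(2)[OF \<epsilon>_lim, of "norm u"] by simp
          then show ?thesis
            by (intro tendsto_eventually) (auto elim!: eventually_mono)
        qed
      qed
      show "AE u in \<nu>. norm (indicat_real {u. \<epsilon> k < norm u} u *\<^sub>R levy_kernel R t u) \<le>
        (norm t)\<^sup>2 * (indicat_real {u. norm u \<le> R} u * (norm u)\<^sup>2) + 2 * indicat_real {u. R < norm u} u" for k
        using norm_levy_kernel[of R t] by (intro AE_I2 order.trans[OF _ norm_levy_kernel[of R t]]) (auto simp: indicator_def)
    qed measurable
    then have "(\<lambda>k. exp (\<integral>u. indicat_real {u. \<epsilon> k < norm u} u *\<^sub>R levy_kernel R t u \<partial>\<nu>)) \<longlonglongrightarrow> (\<integral>x. iexp (t \<bullet> x) \<partial>\<mu>')"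
      unfolding char by (rule tendsto_exp)
    moreover have "(\<lambda>k. (\<integral>x. iexp (t \<bullet> x) \<partial>\<mu> k) - exp (\<integral>u. indicat_real {u. \<epsilon> k < norm u} u *\<^sub>R levy_kernel R t u \<partial>\<nu>)) \<longlonglongrightarrow> 0"
      by (rule Lim_null_comparison[OF _ \<epsilon>_lim]) (intro always_eventually allI \<mu>(3))
    ultimately show ?thesis
      by (rule Lim_transform)
  qed
  have "measure \<mu>' {x. r' \<le> norm x} \<le> q"
    by (rule char_convergence_tail[OF \<mu>(1,2) _ _ conv r(2) \<mu>(4)])
      (auto simp: \<mu>'_def intro!: M.prob_space_distr)
  moreover have "measure \<mu>' {x. r' \<le> norm x} = measure M {w \<in> space M. r' \<le> norm (X w - b)}"
    unfolding \<mu>'_def by (subst measure_distr) (auto intro!: arg_cong[where f="measure M"])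
  ultimately show ?thesis
    using that unfolding q_def by simp
qed

end

section \<open>Stable vectors\<close>

lemma emeasure_finite_sphere_measure:
  assumes "finite_sphere_measure \<sigma>"
  shows "space \<sigma> = sphere 0 1" "emeasure \<sigma> (sphere 0 1) = ennreal (measure \<sigma> (sphere 0 1))"
proof -
  show sp: "space \<sigma> = sphere 0 1"
    using assms sets_eq_imp_space_eq[of \<sigma> "restrict_space borel (sphere 0 1)"]
    by (auto simp: finite_sphere_measure_def space_restrict_space)
  show "emeasure \<sigma> (sphere 0 1) = ennreal (measure \<sigma> (sphere 0 1))"
    using assms finite_measure.emeasure_finite[of \<sigma>] by (auto simp: finite_sphere_measure_def emeasure_eq_ennreal_measure top.not_eq_extremum)
qed

text \<open>The definition gives the polar formula for sets only. It identifies \<open>\<nu>\<close>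
  with the image of a weighted product measure under
  \<open>(\<xi>, r) \<mapsto> r *\<^sub>R \<xi>\<close>, and integrals of all nonnegative functions
  follow.\<close>

lemma nn_integral_stable_levy_measure:
  fixes \<sigma> :: "'v::euclidean_space measure"
  assumes \<sigma>: "finite_sphere_measure \<sigma>" and \<nu>: "stable_levy_measure \<alpha> \<sigma> \<nu>"
    and g [measurable]: "g \<in> borel_measurable borel"
  shows "(\<integral>\<^sup>+u. g u \<partial>\<nu>) =
    (\<integral>\<^sup>+\<xi>. (\<integral>\<^sup>+r\<in>{0<..}. g (r *\<^sub>R \<xi>) * ennreal (1 / r powr (1 + \<alpha>)) \<partial>lborel) \<partial>\<sigma>)"
proof -
  define w where "w z = ennreal (1 / snd z powr (1 + \<alpha>)) * indicator {0<..} (snd z)" for z :: "'v \<times> real"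
  define D where "D = density (\<sigma> \<Otimes>\<^sub>M lborel) w"
  have [measurable]: "(\<lambda>x. x) \<in> borel_measurable \<sigma>"
    using \<sigma> by (simp add: finite_sphere_measure_def measurable_cong_sets[of \<sigma> "restrict_space borel (sphere 0 1)"] measurable_restrict_space1)
  have [measurable]: "w \<in> borel_measurable (\<sigma> \<Otimes>\<^sub>M lborel)"
    unfolding w_def by measurable
  have [measurable]: "(\<lambda>z. snd z *\<^sub>R fst z) \<in> borel_measurable (\<sigma> \<Otimes>\<^sub>M lborel)"
    by measurable
  have D: "(\<integral>\<^sup>+u. h u \<partial>distr D borel (\<lambda>z. snd z *\<^sub>R fst z)) =
    (\<integral>\<^sup>+\<xi>. (\<integral>\<^sup>+r\<in>{0<..}. h (r *\<^sub>R \<xi>) * ennreal (1 / r powr (1 + \<alpha>)) \<partial>lborel) \<partial>\<sigma>)"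
    if [measurable]: "h \<in> borel_measurable borel" for h :: "'v \<Rightarrow> ennreal"
  proof -
    have "(\<integral>\<^sup>+u. h u \<partial>distr D borel (\<lambda>z. snd z *\<^sub>R fst z)) = (\<integral>\<^sup>+z. w z * h (snd z *\<^sub>R fst z) \<partial>(\<sigma> \<Otimes>\<^sub>M lborel))"
      unfolding D_def by (simp add: nn_integral_distr nn_integral_density)
    also have "\<dots> = (\<integral>\<^sup>+\<xi>. \<integral>\<^sup>+r. w (\<xi>, r) * h (r *\<^sub>R \<xi>) \<partial>lborel \<partial>\<sigma>)"
      by (subst lborel.nn_integral_fst[symmetric]) auto
    finally show ?thesis
      by (simp add: w_def mult_ac)
  qed
  have "\<nu> = distr D borel (\<lambda>z. snd z *\<^sub>R fst z)"
  proof (rule measure_eqI)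
    show "sets \<nu> = sets (distr D borel (\<lambda>z. snd z *\<^sub>R fst z))"
      using \<nu> by (simp add: stable_levy_measure_def)
    fix B assume "B \<in> sets \<nu>"
    then have B [measurable]: "B \<in> sets borel"
      using \<nu> by (simp add: stable_levy_measure_def)
    have "emeasure \<nu> B = (\<integral>\<^sup>+\<xi>. (\<integral>\<^sup>+r\<in>{0<..}. indicator B (r *\<^sub>R \<xi>) * ennreal (1 / r powr (1 + \<alpha>)) \<partial>lborel) \<partial>\<sigma>)"
      using \<nu> B unfolding stable_levy_measure_def by blast
    also have "\<dots> = (\<integral>\<^sup>+u. indicator B u \<partial>distr D borel (\<lambda>z. snd z *\<^sub>R fst z))"
      by (rule D[symmetric]) measurable
    finally show "emeasure \<nu> B = emeasure (distr D borel (\<lambda>z. snd z *\<^sub>R fst z)) B"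
      by simp
  qed
  then show ?thesis using D[OF g] by simp
qed

lemma nn_integral_radial_stable_levy_measure:
  fixes \<sigma> :: "'v::euclidean_space measure"
  assumes \<sigma>: "finite_sphere_measure \<sigma>" and \<nu>: "stable_levy_measure \<alpha> \<sigma> \<nu>"
    and h: "(\<lambda>u::'v. h (norm u)) \<in> borel_measurable borel"
  shows "(\<integral>\<^sup>+u. h (norm u) \<partial>\<nu>) =
    ennreal (measure \<sigma> (sphere 0 1)) * (\<integral>\<^sup>+r\<in>{0<..}. h r * ennreal (1 / r powr (1 + \<alpha>)) \<partial>lborel)"
proof -
  have "(\<integral>\<^sup>+u. h (norm u) \<partial>\<nu>) =
    (\<integral>\<^sup>+\<xi>. (\<integral>\<^sup>+r\<in>{0<..}. h (norm (r *\<^sub>R \<xi>)) * ennreal (1 / r powr (1 + \<alpha>)) \<partial>lborel) \<partial>\<sigma>)"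
    by (rule nn_integral_stable_levy_measure[OF \<sigma> \<nu> h])
  also have "\<dots> = (\<integral>\<^sup>+\<xi>. (\<integral>\<^sup>+r\<in>{0<..}. h r * ennreal (1 / r powr (1 + \<alpha>)) \<partial>lborel) \<partial>\<sigma>)"
    by (intro nn_integral_cong) (auto simp: emeasure_finite_sphere_measure[OF \<sigma>] indicator_def intro!: nn_integral_cong)
  finally show ?thesis
    by (simp add: emeasure_finite_sphere_measure[OF \<sigma>] mult.commute)
qed

lemma emeasure_stable_tail:
  fixes \<sigma> :: "'v::euclidean_space measure"
  assumes \<sigma>: "finite_sphere_measure \<sigma>" and \<nu>: "stable_levy_measure \<alpha> \<sigma> \<nu>" and \<alpha>: "0 < \<alpha>" and R: "0 < R"
  shows "emeasure \<nu> {u. R < norm u} = ennreal (measure \<sigma> (sphere 0 1) * (R powr - \<alpha> / \<alpha>))"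
proof -
  have [measurable_cong]: "sets \<nu> = sets borel" using \<nu> by (simp add: stable_levy_measure_def)
  have "emeasure \<nu> {u. R < norm u} = (\<integral>\<^sup>+u. indicator {u. R < norm u} u \<partial>\<nu>)"
    by (rule nn_integral_indicator[symmetric]) measurable
  also have "\<dots> = (\<integral>\<^sup>+u. indicator {R<..} (norm u) \<partial>\<nu>)"
    by (intro nn_integral_cong) (simp add: indicator_def)
  also have "\<dots> = ennreal (measure \<sigma> (sphere 0 1)) * (\<integral>\<^sup>+r\<in>{0<..}. indicator {R<..} r * ennreal (1 / r powr (1 + \<alpha>)) \<partial>lborel)"
    by (rule nn_integral_radial_stable_levy_measure[OF \<sigma> \<nu>]) measurable
  also have "(\<integral>\<^sup>+r\<in>{0<..}. indicator {R<..} r * ennreal (1 / r powr (1 + \<alpha>)) \<partial>lborel) =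
      (\<integral>\<^sup>+r. ennreal (r powr - (1 + \<alpha>)) * indicator {R..} r \<partial>lborel)"
  \<comment> \<open>The open and the closed half-line differ only at the null point
    \<open>R\<close>.\<close>
  proof (rule nn_integral_cong_AE)
    have "1 / x powr (1 + \<alpha>) = x powr (- 1 - \<alpha>)" for x :: real
      using powr_minus_divide[of x "1 + \<alpha>"] by simp
    then show "AE r in lborel. indicator {R<..} r * ennreal (1 / r powr (1 + \<alpha>)) * indicator {0<..} r =
        ennreal (r powr - (1 + \<alpha>)) * indicator {R..} r"
      using R AE_lborel_singleton[of R] by (auto elim!: eventually_mono simp: indicator_def)
  qed
  also have "\<dots> = ennreal (R powr - \<alpha> / \<alpha>)"
    using has_integral_powr_to_inf[of "- (1 + \<alpha>)" R] \<alpha> R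
    by (subst nn_integral_has_integral_lebesgue') auto
  finally show ?thesis
    by (simp only: ennreal_mult'[OF measure_nonneg])
qed

lemma truncated_second_moment_stable:
  fixes \<sigma> :: "'v::euclidean_space measure"
  assumes \<sigma>: "finite_sphere_measure \<sigma>" and \<nu>: "stable_levy_measure \<alpha> \<sigma> \<nu>" and \<alpha>: "\<alpha> < 2" and R: "0 < R"
  shows "has_bochner_integral \<nu> (\<lambda>u. indicat_real {u. norm u \<le> R} u * (norm u)\<^sup>2)
    (measure \<sigma> (sphere 0 1) * (R powr (2 - \<alpha>) / (2 - \<alpha>)))"
proof (rule has_bochner_integral_nn_integral)
  have [measurable_cong]: "sets \<nu> = sets borel" using \<nu> by (simp add: stable_levy_measure_def)
  show "(\<lambda>u. indicat_real {u. norm u \<le> R} u * (norm u)\<^sup>2) \<in> borel_measurable \<nu>" by measurable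
  have "(\<integral>\<^sup>+u. ennreal (indicat_real {u. norm u \<le> R} u * (norm u)\<^sup>2) \<partial>\<nu>) =
    (\<integral>\<^sup>+u. ennreal (indicat_real {..R} (norm u) * (norm u)\<^sup>2) \<partial>\<nu>)"
    by (intro nn_integral_cong) (auto simp: indicator_def)
  also have "\<dots> = ennreal (measure \<sigma> (sphere 0 1)) *
      (\<integral>\<^sup>+r\<in>{0<..}. ennreal (indicat_real {..R} r * r\<^sup>2) * ennreal (1 / r powr (1 + \<alpha>)) \<partial>lborel)"
    by (rule nn_integral_radial_stable_levy_measure[OF \<sigma> \<nu>]) measurable
  also have "(\<integral>\<^sup>+r\<in>{0<..}. ennreal (indicat_real {..R} r * r\<^sup>2) * ennreal (1 / r powr (1 + \<alpha>)) \<partial>lborel) =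
      (\<integral>\<^sup>+r. ennreal (r powr (1 - \<alpha>)) * indicator {0..R} r \<partial>lborel)"
  proof (intro nn_integral_cong)
    fix r :: real
    have "r\<^sup>2 * (1 / r powr (1 + \<alpha>)) = r powr (1 - \<alpha>)" if "0 < r"
    proof -
      have "r\<^sup>2 * (1 / r powr (1 + \<alpha>)) = r powr (2 - (1 + \<alpha>))"
        using that by (subst powr_diff) simp
      then show ?thesis by simp
    qed
    then show "ennreal (indicat_real {..R} r * r\<^sup>2) * ennreal (1 / r powr (1 + \<alpha>)) * indicator {0<..} r =
        ennreal (r powr (1 - \<alpha>)) * indicator {0..R} r"
      \<comment> \<open>At \<open>r = 0\<close> both sides vanish, the right one because
        \<open>0 powr x = 0\<close>.\<close>
      by (cases "r = 0") (auto simp: indicator_def simp flip: ennreal_mult)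
  qed
  also have "\<dots> = ennreal (R powr (2 - \<alpha>) / (2 - \<alpha>))"
    using has_integral_powr_from_0[of "1 - \<alpha>" R] \<alpha> R
    by (subst nn_integral_has_integral_lebesgue') auto
  finally show "(\<integral>\<^sup>+u. ennreal (indicat_real {u. norm u \<le> R} u * (norm u)\<^sup>2) \<partial>\<nu>) =
     ennreal (measure \<sigma> (sphere 0 1) * (R powr (2 - \<alpha>) / (2 - \<alpha>)))"
    by (simp only: ennreal_mult'[OF measure_nonneg])
qed (use \<alpha> in auto)

lemma levy_measure_stable:
  assumes "finite_sphere_measure \<sigma>" "stable_levy_measure \<alpha> \<sigma> \<nu>" "0 < \<alpha>" "\<alpha> < 2"
  shows "levy_measure \<nu>"
proof
  show "sets \<nu> = sets borel" using assms by (simp add: stable_levy_measure_def)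
  show "emeasure \<nu> {u. r < norm u} < \<infinity>" if "0 < r" for r
    using emeasure_stable_tail[OF assms(1-3) that] by simp
  show "integrable \<nu> (\<lambda>u. indicat_real {u. norm u \<le> r} u * (norm u)\<^sup>2)" if "0 < r" for r
    using truncated_second_moment_stable[OF assms(1,2,4) that] by (rule integrable.intros)
qed

lemma stable_vector_tail:
  fixes X :: "'w \<Rightarrow> 'v::euclidean_space"
  assumes M: "prob_space M" and X: "stable_vector \<alpha> \<sigma> \<nu> M X" and \<alpha>: "0 < \<alpha>" "\<alpha> < 2" and R: "0 < R"
  obtains b where "measure M {w \<in> space M. 2 * R \<le> norm (X w - b)} \<le>
    measure \<sigma> (sphere 0 1) * R powr - \<alpha> * (1 / \<alpha> + 1 / (2 - \<alpha>))"
proof -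
  have \<sigma>: "finite_sphere_measure \<sigma>" and \<nu>: "stable_levy_measure \<alpha> \<sigma> \<nu>"
    and X_meas: "X \<in> borel_measurable M" and LK: "levy_khintchine M X \<nu>"
    using X by (auto simp: stable_vector_def)
  interpret levy_measure \<nu> by (rule levy_measure_stable[OF \<sigma> \<nu> \<alpha>])
  \<comment> \<open>Truncation level and Chebyshev radius are both \<open>R\<close>; the outer
    radius \<open>2 * R\<close> leaves the strict gap that smoothing requires.\<close>
  obtain b where b: "measure M {w \<in> space M. 2 * R \<le> norm (X w - b)} \<le>
    measure \<nu> {u. R < norm u} + (\<integral>u. indicat_real {u. norm u \<le> R} u * (norm u)\<^sup>2 \<partial>\<nu>) / R\<^sup>2"
    using levy_tail[OF M X_meas LK R R, of "2 * R"] R by auto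
  have "measure \<nu> {u. R < norm u} = measure \<sigma> (sphere 0 1) * (R powr - \<alpha> / \<alpha>)"
    using emeasure_stable_tail[OF \<sigma> \<nu> \<alpha>(1) R] \<alpha> by (simp add: measure_def)
  moreover have "(\<integral>u. indicat_real {u. norm u \<le> R} u * (norm u)\<^sup>2 \<partial>\<nu>) = measure \<sigma> (sphere 0 1) * (R powr (2 - \<alpha>) / (2 - \<alpha>))"
    using truncated_second_moment_stable[OF \<sigma> \<nu> \<alpha>(2) R] by (rule has_bochner_integral_integral_eq)
  \<comment> \<open>With this, the large-jump mass and the variance term scale alike in
    \<open>R\<close>, and their coefficients add.\<close>
  moreover have "R powr (2 - \<alpha>) = R\<^sup>2 * R powr - \<alpha>"
    using R by (simp add: powr_diff powr_minus_divide)
  ultimately have "measure \<nu> {u. R < norm u} + (\<integral>u. indicat_real {u. norm u \<le> R} u * (norm u)\<^sup>2 \<partial>\<nu>) / R\<^sup>2 =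
      measure \<sigma> (sphere 0 1) * R powr - \<alpha> * (1 / \<alpha> + 1 / (2 - \<alpha>))"
    using R by (simp add: distrib_left)
  with b show ?thesis
    by (intro that[of b]) simp
qed

text \<open>Off a set \<open>B\<close> of probability below 1/2, \<open>Y\<close> stays within
  \<open>\<delta> / 2\<close> of \<open>F b\<close>. This locates the median as well as the values
  of \<open>Y\<close>, so no centring of \<open>F\<close> at its mean is involved.\<close>

lemma lipschitz_stable_deviation:
  fixes X :: "'w \<Rightarrow> 'v::euclidean_space" and F :: "'v \<Rightarrow> real"
  assumes M: "prob_space M" and X: "stable_vector \<alpha> \<sigma> \<nu> M X" and \<alpha>: "0 < \<alpha>" "\<alpha> < 2"
    and L: "0 < L" and F: "\<And>x y. \<bar>F x - F y\<bar> \<le> L * norm (x - y)"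
    and Y: "\<And>w. w \<in> space M \<Longrightarrow> Y w = F (X w)"
    and med: "is_median M Y m"
    and \<delta>: "L * (2 * measure \<sigma> (sphere 0 1) * stable_const \<alpha>) powr (1 / \<alpha>) < \<delta>"
  shows "\<P>(w in M. Y w - m \<ge> \<delta>) \<le> stable_const \<alpha> * L powr \<alpha> * (measure \<sigma> (sphere 0 1) / \<delta> powr \<alpha>)"
proof -
  interpret prob_space M by fact
  have [measurable]: "X \<in> borel_measurable M" using X by (simp add: stable_vector_def)
  define s where "s = measure \<sigma> (sphere 0 1)"
  have s: "0 \<le> s" by (simp add: s_def)
  have C: "0 < stable_const \<alpha>"
    unfolding stable_const_def using \<alpha> by (intro divide_pos_pos mult_pos_pos add_pos_pos) auto
  have "0 \<le> L * (2 * s * stable_const \<alpha>) powr (1 / \<alpha>)" using L by simp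
  with \<delta> have \<delta>0: "0 < \<delta>" by (simp add: s_def)
  \<comment> \<open>Chosen so that \<open>L * (2 * R) = \<delta> / 2\<close>. Raising the 4 to the
    power \<open>\<alpha>\<close> produces the factor \<open>4 powr \<alpha>\<close> of
    \<open>stable_const\<close>.\<close>
  define R where "R = \<delta> / (4 * L)"
  have R: "0 < R" using \<delta>0 L by (simp add: R_def)
  obtain b where b: "measure M {w \<in> space M. 2 * R \<le> norm (X w - b)} \<le> s * R powr - \<alpha> * (1 / \<alpha> + 1 / (2 - \<alpha>))"
    using stable_vector_tail[OF M X \<alpha> R] unfolding s_def by blast
  define B where "B = {w \<in> space M. 2 * R \<le> norm (X w - b)}"
  have [measurable]: "B \<in> sets M" unfolding B_def by measurable
  define q where "q = stable_const \<alpha> * L powr \<alpha> * (s / \<delta> powr \<alpha>)"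
  have Rpow: "R powr - \<alpha> = 4 powr \<alpha> * L powr \<alpha> / \<delta> powr \<alpha>"
    using \<delta>0 L by (simp add: R_def powr_minus powr_divide powr_mult field_simps)
  \<comment> \<open>The bound from \<open>stable_vector_tail\<close> has coefficient 1 where
    \<open>stable_const\<close> has \<open>exp 1\<close>.\<close>
  have "1 / \<alpha> + 1 / (2 - \<alpha>) \<le> (2 - \<alpha> + exp 1 * \<alpha>) / (\<alpha> * (2 - \<alpha>))"
  proof -
    have "1 / \<alpha> + 1 / (2 - \<alpha>) = (2 - \<alpha> + 1 * \<alpha>) / (\<alpha> * (2 - \<alpha>))"
      using \<alpha> by (simp add: field_simps)
    also have "\<dots> \<le> (2 - \<alpha> + exp 1 * \<alpha>) / (\<alpha> * (2 - \<alpha>))"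
      using \<alpha> by (intro divide_right_mono add_left_mono mult_right_mono) auto
    finally show ?thesis .
  qed
  then have "s * R powr - \<alpha> * (1 / \<alpha> + 1 / (2 - \<alpha>)) \<le> s * R powr - \<alpha> * ((2 - \<alpha> + exp 1 * \<alpha>) / (\<alpha> * (2 - \<alpha>)))"
    using s by (intro mult_left_mono) auto
  also have "\<dots> = q"
    by (simp add: q_def Rpow stable_const_def mult_ac)
  finally have Bq: "prob B \<le> q" using b unfolding B_def by linarith
  \<comment> \<open>The hypothesis on \<open>\<delta>\<close>, raised to the power
    \<open>\<alpha>\<close>, is the inequality \<open>2 * q < 1\<close>.\<close>
  have q: "q < 1 / 2"
  proof -
    have "(2 * s * stable_const \<alpha>) powr (1 / \<alpha>) < \<delta> / L"
      using \<delta> L by (simp add: s_def field_simps)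
    then have "((2 * s * stable_const \<alpha>) powr (1 / \<alpha>)) powr \<alpha> < (\<delta> / L) powr \<alpha>"
      using \<alpha> by (intro powr_less_mono2) auto
    then have "2 * s * stable_const \<alpha> < \<delta> powr \<alpha> / L powr \<alpha>"
      using \<alpha> s C \<delta>0 L by (simp add: powr_powr powr_divide)
    then show ?thesis using \<delta>0 L by (simp add: q_def field_simps)
  qed
  have near: "\<bar>Y w - F b\<bar> < \<delta> / 2" if "w \<in> space M" "w \<notin> B" for w
  proof -
    have "norm (X w - b) < 2 * R" using that by (simp add: B_def)
    then have "L * norm (X w - b) < L * (2 * R)" using L by simp
    also have "\<dots> = \<delta> / 2" using L by (simp add: R_def)
    finally show ?thesis using F[of "X w" b] Y[OF that(1)] by simp
  qed
  \<comment> \<open>The event \<open>Y w \<le> m\<close> has probability at least 1/2, too much to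
    fit into \<open>B\<close>. A point of it outside \<open>B\<close> gives the lower bound for
    \<open>m\<close>.\<close>
  have "\<not> {w \<in> space M. Y w \<le> m} \<subseteq> B"
  proof
    assume "{w \<in> space M. Y w \<le> m} \<subseteq> B"
    then have "prob {w \<in> space M. Y w \<le> m} \<le> prob B" by (intro finite_measure_mono) auto
    with Bq q med show False by (simp add: is_median_def)
  qed
  then obtain w where "w \<in> space M" "Y w \<le> m" "w \<notin> B" by blast
  with near[of w] have m: "F b - \<delta> / 2 < m" by linarith
  have "{w \<in> space M. Y w - m \<ge> \<delta>} \<subseteq> B"
  proof
    fix w assume w: "w \<in> {w \<in> space M. Y w - m \<ge> \<delta>}"
    then have "\<delta> / 2 < Y w - F b" using m by (simp add: field_simps)
    then have "\<not> \<bar>Y w - F b\<bar> < \<delta> / 2" by linarith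
    with near[of w] w show "w \<in> B" by blast
  qed
  then have "prob {w \<in> space M. Y w - m \<ge> \<delta>} \<le> prob B" by (intro finite_measure_mono) auto
  with Bq show ?thesis unfolding q_def s_def by linarith
qed

theorem theorem1p7:
  fixes M :: "'w measure"
    and \<omega> :: "'n::{finite,linorder} \<Rightarrow> 'n \<Rightarrow> 'w \<Rightarrow> complex"
    and A :: "complex^'n::{finite,linorder}^'n::{finite,linorder}"
    and \<sigma> \<nu> :: "(real^('n::{finite,linorder} \<times> 'n::{finite,linorder})) measure"
    and a \<alpha> :: real
  assumes "prob_space M"
    and "\<And>i j. \<omega> i j \<in> borel_measurable M"
    and "\<And>i j w. w \<in> space M \<Longrightarrow> \<omega> i j w = cnj (\<omega> j i w)"
    and "hermitian A" and "0 < a" and "\<And>i j. cmod (A $ i $ j) \<le> a"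
    and "0 < \<alpha>" and "\<alpha> < 2"
    and "stable_vector \<alpha> \<sigma> \<nu> M (param_vector \<omega>)"
  shows
    "(\<forall>f m \<delta>. 1-lipschitz_on UNIV f \<longrightarrow>
        is_median M (\<lambda>w. Re (tr_N (matrix_fun f (random_matrix A \<omega> w)))) m \<longrightarrow>
        \<delta> * real CARD('n) >
          sqrt 2 * a * (2 * measure \<sigma> (sphere 0 1) * stable_const \<alpha>) powr (1 / \<alpha>) \<longrightarrow>
        \<P>(w in M. Re (tr_N (matrix_fun f (random_matrix A \<omega> w))) - m \<ge> \<delta>)
          \<le> stable_const \<alpha> * (sqrt 2 * a) powr \<alpha> *
             (measure \<sigma> (sphere 0 1) / (real CARD('n) powr \<alpha> * \<delta> powr \<alpha>)))
     \<and>
     (\<forall>m \<delta>. is_median M (\<lambda>w. lambda_max (random_matrix A \<omega> w)) m \<longrightarrow>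
        \<delta> * sqrt (real CARD('n)) >
          sqrt 2 * a * (2 * measure \<sigma> (sphere 0 1) * stable_const \<alpha>) powr (1 / \<alpha>) \<longrightarrow>
        \<P>(w in M. lambda_max (random_matrix A \<omega> w) - m \<ge> \<delta>)
          \<le> stable_const \<alpha> * (sqrt 2 * a) powr \<alpha> *
             (measure \<sigma> (sphere 0 1) / (real CARD('n) powr (\<alpha> / 2) * \<delta> powr \<alpha>)))"
proof (intro conjI allI impI)
  have eq: "random_matrix A \<omega> w = param_matrix A (param_vector \<omega> w)" if "w \<in> space M" for w
    using assms(3)[OF that] by (rule random_matrix_eq_param_matrix)
  note herm = hermitian_param_matrix[OF \<open>hermitian A\<close>]
  note lip = norm_param_matrix_diff[of A a, OF assms(6)]
  have N: "0 < real CARD('n)" by simp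
  show "\<P>(w in M. Re (tr_N (matrix_fun f (random_matrix A \<omega> w))) - m \<ge> \<delta>)
      \<le> stable_const \<alpha> * (sqrt 2 * a) powr \<alpha> *
        (measure \<sigma> (sphere 0 1) / (real CARD('n) powr \<alpha> * \<delta> powr \<alpha>))"
    if f: "1-lipschitz_on UNIV f"
      and med: "is_median M (\<lambda>w. Re (tr_N (matrix_fun f (random_matrix A \<omega> w)))) m"
      and \<delta>: "\<delta> * real CARD('n) > sqrt 2 * a * (2 * measure \<sigma> (sphere 0 1) * stable_const \<alpha>) powr (1 / \<alpha>)"
    for f m \<delta>
  proof -
    \<comment> \<open>One factor \<open>1 / sqrt N\<close>, with \<open>N = CARD('n)\<close>, comes
      from the scaling of the matrix and a second from the normalised trace.\<close>
    define L where "L = sqrt 2 * a / CARD('n)"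
    have L: "0 < L" using \<open>0 < a\<close> N by (simp add: L_def)
    have "\<P>(w in M. Re (tr_N (matrix_fun f (random_matrix A \<omega> w))) - m \<ge> \<delta>)
      \<le> stable_const \<alpha> * L powr \<alpha> * (measure \<sigma> (sphere 0 1) / \<delta> powr \<alpha>)"
    proof (rule lipschitz_stable_deviation[OF assms(1,9,7,8) L _ _ med])
      fix x y :: "real^('n \<times> 'n)"
      have "\<bar>Re (tr_N (matrix_fun f (param_matrix A x))) - Re (tr_N (matrix_fun f (param_matrix A y)))\<bar>
          \<le> norm (param_matrix A x - param_matrix A y) / sqrt (CARD('n))"
        by (rule tr_N_lipschitz[OF f herm herm])
      also have "\<dots> \<le> (sqrt 2 * a / sqrt (CARD('n)) * norm (x - y)) / sqrt (CARD('n))"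
        by (intro divide_right_mono lip) simp
      also have "\<dots> = L * norm (x - y)" by (simp add: L_def field_simps)
      finally show "\<bar>Re (tr_N (matrix_fun f (param_matrix A x))) - Re (tr_N (matrix_fun f (param_matrix A y)))\<bar> \<le> L * norm (x - y)" .
    next
      show "L * (2 * measure \<sigma> (sphere 0 1) * stable_const \<alpha>) powr (1 / \<alpha>) < \<delta>"
        using \<delta> N by (simp add: L_def pos_divide_less_eq)
    qed (simp add: eq)
    also have "\<dots> = stable_const \<alpha> * (sqrt 2 * a) powr \<alpha> *
        (measure \<sigma> (sphere 0 1) / (real CARD('n) powr \<alpha> * \<delta> powr \<alpha>))"
      using \<open>0 < a\<close> N by (simp add: L_def powr_divide)
    finally show ?thesis .
  qed
  show "\<P>(w in M. lambda_max (random_matrix A \<omega> w) - m \<ge> \<delta>)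
      \<le> stable_const \<alpha> * (sqrt 2 * a) powr \<alpha> *
        (measure \<sigma> (sphere 0 1) / (real CARD('n) powr (\<alpha> / 2) * \<delta> powr \<alpha>))"
    if med: "is_median M (\<lambda>w. lambda_max (random_matrix A \<omega> w)) m"
      and \<delta>: "\<delta> * sqrt (real CARD('n)) > sqrt 2 * a * (2 * measure \<sigma> (sphere 0 1) * stable_const \<alpha>) powr (1 / \<alpha>)"
    for m \<delta>
  proof -
    \<comment> \<open>Here only the scaling of the matrix contributes, which leads to the exponent
      \<open>\<alpha> / 2\<close> of the dimension.\<close>
    define L where "L = sqrt 2 * a / sqrt (CARD('n))"
    have L: "0 < L" using \<open>0 < a\<close> N by (simp add: L_def)
    have "\<P>(w in M. lambda_max (random_matrix A \<omega> w) - m \<ge> \<delta>)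
      \<le> stable_const \<alpha> * L powr \<alpha> * (measure \<sigma> (sphere 0 1) / \<delta> powr \<alpha>)"
    proof (rule lipschitz_stable_deviation[OF assms(1,9,7,8) L _ _ med])
      fix x y :: "real^('n \<times> 'n)"
      show "\<bar>lambda_max (param_matrix A x) - lambda_max (param_matrix A y)\<bar> \<le> L * norm (x - y)"
        using lambda_max_lipschitz[OF herm herm, of x y] lip[of x y] unfolding L_def by linarith
    next
      show "L * (2 * measure \<sigma> (sphere 0 1) * stable_const \<alpha>) powr (1 / \<alpha>) < \<delta>"
        using \<delta> N by (simp add: L_def pos_divide_less_eq)
    qed (simp add: eq)
    also have "L powr \<alpha> = (sqrt 2 * a) powr \<alpha> / real CARD('n) powr (\<alpha> / 2)"
      using \<open>0 < a\<close> N by (simp add: L_def powr_divide powr_powr flip: powr_half_sqrt)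
    finally show ?thesis by simp
  qed
qed

end
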